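(* If $G$ is a connected graph of order at least $3$, then \[ \gamma_{\mathrm{nt}}(G) \le \alpha'(G) + \frac{1}{2}\mathrm{pc}(G) \] unless $G \in \{P_3, P_5, C_5\}$ (up to isomorphism), in which case $\gamma_{\mathrm{nt}}(G) = \alpha'(G) + \frac{1}{2}(\mathrm{pc}(G)+1)$.
   Context: All graphs are finite and simple. $P_n$ and $C_n$ denote the path and the cycle on $n$ vertices. For a vertex $v$ of $G$, $N(v)$ denotes the set of vertices adjacent to $v$; for $S \subseteq V(G)$, the open neighborhood is $N(S) = \bigcup_{v \in S} N(v)$ (which may contain vertices of $S$). A dominating set of $G$ is a set $S \subseteq V(G)$ such that every vertex in $V(G)\setminus S$ is adjacent to a vertex of $S$. A neighborhood total dominating set (NTD-set) of a graph $G$ with no isolated vertex is a dominating set $S$ of $G$ such that the subgraph $G[N(S)]$ induced by $N(S)$ has no isolated vertex; the neighborhood total domination number $\gamma_{\mathrm{nt}}(G)$ is the minimum cardinality of an NTD-set of $G$. The matching number $\alpha'(G)$ is the maximum number of edges in a matching (set of pairwise non-adjacent edges) of $G$. A path cover of $G$ is a collection of vertex-disjoint paths (subgraphs of $G$, single vertices allowed) such that every vertex of $G$ belongs to exactly one of the paths; the path covering number $\mathrm{pc}(G)$ is the minimum cardinality of a path cover of $G$. *)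

theory Defs
  imports Complex_Main
begin

record 'a ugraph =
  verts :: "'a set"
  edges :: "'a set set"

definition simple_graph :: "'a ugraph \<Rightarrow> bool" where
  "simple_graph G \<longleftrightarrow> finite (verts G) \<and> (\<forall>e\<in>edges G. e \<subseteq> verts G \<and> card e = 2)"

definition adjacent :: "'a ugraph \<Rightarrow> 'a \<Rightarrow> 'a \<Rightarrow> bool" where
  "adjacent G u v \<longleftrightarrow> {u, v} \<in> edges G"

definition connected_graph :: "'a ugraph \<Rightarrow> bool" where
  "connected_graph G \<longleftrightarrow>
     verts G \<noteq> {} \<and> (\<forall>u\<in>verts G. \<forall>v\<in>verts G. (adjacent G)\<^sup>*\<^sup>* u v)"

definition subgraph :: "'a ugraph \<Rightarrow> 'a ugraph \<Rightarrow> bool" where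
  "subgraph H G \<longleftrightarrow> simple_graph H \<and> verts H \<subseteq> verts G \<and> edges H \<subseteq> edges G"

definition induced_subgraph :: "'a ugraph \<Rightarrow> 'a set \<Rightarrow> 'a ugraph" where
  "induced_subgraph G X = \<lparr>verts = X, edges = {e \<in> edges G. e \<subseteq> X}\<rparr>"

definition isomorphic :: "'a ugraph \<Rightarrow> 'b ugraph \<Rightarrow> bool" where
  "isomorphic G H \<longleftrightarrow>
     (\<exists>f. bij_betw f (verts G) (verts H) \<and>
          (\<forall>u\<in>verts G. \<forall>v\<in>verts G. adjacent G u v \<longleftrightarrow> adjacent H (f u) (f v)))"

definition path_graph :: "nat \<Rightarrow> nat ugraph" where
  "path_graph n = \<lparr>verts = {..<n}, edges = {{i, Suc i} | i. Suc i < n}\<rparr>"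

(* The cycle on n vertices, for n \<ge> 3. *)
definition cycle_graph :: "nat \<Rightarrow> nat ugraph" where
  "cycle_graph n = \<lparr>verts = {..<n}, edges = {{i, Suc i mod n} | i. i < n}\<rparr>"

definition neighborhood :: "'a ugraph \<Rightarrow> 'a \<Rightarrow> 'a set" where
  "neighborhood G v = {u \<in> verts G. adjacent G v u}"

definition open_neighborhood :: "'a ugraph \<Rightarrow> 'a set \<Rightarrow> 'a set" where
  "open_neighborhood G S = (\<Union>v\<in>S. neighborhood G v)"

definition no_isolated_vertex :: "'a ugraph \<Rightarrow> bool" where
  "no_isolated_vertex G \<longleftrightarrow> (\<forall>v\<in>verts G. neighborhood G v \<noteq> {})"

definition dominating_set :: "'a ugraph \<Rightarrow> 'a set \<Rightarrow> bool" where
  "dominating_set G S \<longleftrightarrow>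
     S \<subseteq> verts G \<and> (\<forall>v\<in>verts G - S. \<exists>u\<in>S. adjacent G v u)"

definition ntd_set :: "'a ugraph \<Rightarrow> 'a set \<Rightarrow> bool" where
  "ntd_set G S \<longleftrightarrow>
     dominating_set G S \<and> no_isolated_vertex (induced_subgraph G (open_neighborhood G S))"

(* Meaningful for finite graphs without isolated vertices: there the set of all vertices
   is an NTD-set, so the minimum is attained. *)
definition ntd_number :: "'a ugraph \<Rightarrow> nat" where
  "ntd_number G = (LEAST k. \<exists>S. ntd_set G S \<and> card S = k)"

definition matching :: "'a ugraph \<Rightarrow> 'a set set \<Rightarrow> bool" where
  "matching G M \<longleftrightarrow> M \<subseteq> edges G \<and> pairwise disjnt M"

definition matching_number :: "'a ugraph \<Rightarrow> nat" where
  "matching_number G = Max (card ` {M. matching G M})"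

definition is_path :: "'a ugraph \<Rightarrow> bool" where
  "is_path P \<longleftrightarrow> (\<exists>n\<ge>1. isomorphic P (path_graph n))"

(* Unique existence expresses both covering and vertex-disjointness. *)
definition path_cover :: "'a ugraph \<Rightarrow> 'a ugraph set \<Rightarrow> bool" where
  "path_cover G C \<longleftrightarrow>
     (\<forall>P\<in>C. subgraph P G \<and> is_path P) \<and> (\<forall>v\<in>verts G. \<exists>!P. P \<in> C \<and> v \<in> verts P)"

definition path_covering_number :: "'a ugraph \<Rightarrow> nat" where
  "path_covering_number G = (LEAST k. \<exists>C. path_cover G C \<and> card C = k)"

end

theory Submission
  imports Defs
begin

text \<open>
  Write \<open>n\<close> for the order of \<open>G\<close>. Every path on \<open>k\<close> vertices contains a matching that misses at
  most one of them, so a minimum path cover yields \<open>n \<le> 2 \<alpha>' + pc\<close>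
  (\<open>order_le_matching_plus_cover\<close>). Hence an NTD-set with at most \<open>n / 2\<close> vertices proves
  the inequality, and only graphs without such a set need further attention.

  The structural core is \<open>connected_set_dichotomy\<close>: a connected graph either has an NTD-set on at
  most half of its vertices, or is a single edge, or is spanned by a spider, that is, by a star all of
  whose edges are subdivided once (a single vertex is a spider without legs). It rests on the
  observation that NTD-sets of disjoint vertex sets can be united. If the graph splits into two
  connected parts that are neither edges nor spanned by spiders, induction applies to both parts.
  If no such split exists, some vertex \<open>r\<close> has the property that the rest of the graph
  consists of edges and spiders, each attached to \<open>r\<close>. A case distinction on these branches
  (\<open>hub_dichotomy\<close>) then finishes the argument: once \<open>r\<close> is chosen, an edge costs half
  of its vertices, and a spider on \<open>2k + 1\<close> vertices costs only \<open>k\<close>, so that one spider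
  pays for \<open>r\<close>.

  Suppose first \<open>pc \<ge> 2\<close>. A spanning spider on \<open>n \<ge> 3\<close> vertices has an NTD-set of size
  \<open>(n + 1) / 2\<close> and a matching of size \<open>(n - 1) / 2\<close>, and \<open>pc \<ge> 2\<close> makes up for the
  difference. Suppose next \<open>pc = 1\<close>. Then \<open>G\<close> has a Hamiltonian path, and a path on \<open>n \<ge> 4\<close>
  vertices with \<open>n \<noteq> 5\<close> has an NTD-set of size at most \<open>n / 2\<close>, as it can be cut into blocks of
  orders 4, 6, 7 and 9 that have one (\<open>path_half_secured\<close>). For \<open>n = 3\<close> and \<open>n = 5\<close> any
  chord that distinguishes \<open>G\<close> from \<open>P\<^sub>3\<close>, \<open>P\<^sub>5\<close> and \<open>C\<^sub>5\<close> admits a set of size 1 or 2. In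
  the three exceptional graphs all parameters are computed explicitly.
\<close>

section \<open>Isomorphism with paths and cycles\<close>

text \<open>Isomorphism to a graph on \<open>{..<n}\<close> amounts to an enumeration of the vertices that
  transports adjacency; in this form paths and cycles are handled by index arithmetic.\<close>

lemma isomorphic_iff_enumeration:
  assumes "verts H = {..<n}"
  shows "isomorphic G H \<longleftrightarrow> (\<exists>g. bij_betw g {..<n} (verts G) \<and>
    (\<forall>i<n. \<forall>j<n. adjacent G (g i) (g j) \<longleftrightarrow> adjacent H i j))"
proof
  assume "isomorphic G H"
  then obtain f where f: "bij_betw f (verts G) {..<n}"
    and adj: "\<forall>u\<in>verts G. \<forall>v\<in>verts G. adjacent G u v \<longleftrightarrow> adjacent H (f u) (f v)"
    unfolding isomorphic_def assms by blast
  let ?g = "inv_into (verts G) f"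
  have g: "bij_betw ?g {..<n} (verts G)" using f by (rule bij_betw_inv_into)
  have "adjacent G (?g i) (?g j) \<longleftrightarrow> adjacent H i j" if "i < n" "j < n" for i j
  proof -
    have "?g i \<in> verts G" "?g j \<in> verts G" using g that by (auto simp: bij_betw_def)
    moreover have "f (?g i) = i" "f (?g j) = j"
      using f that by (auto intro: bij_betw_inv_into_right)
    ultimately show ?thesis using adj by metis
  qed
  then show "\<exists>g. bij_betw g {..<n} (verts G) \<and>
    (\<forall>i<n. \<forall>j<n. adjacent G (g i) (g j) \<longleftrightarrow> adjacent H i j)" using g by blast
next
  assume "\<exists>g. bij_betw g {..<n} (verts G) \<and>
    (\<forall>i<n. \<forall>j<n. adjacent G (g i) (g j) \<longleftrightarrow> adjacent H i j)"
  then obtain g where g: "bij_betw g {..<n} (verts G)"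
    and adj: "\<forall>i<n. \<forall>j<n. adjacent G (g i) (g j) \<longleftrightarrow> adjacent H i j" by blast
  let ?f = "inv_into {..<n} g"
  have f: "bij_betw ?f (verts G) {..<n}" using g by (rule bij_betw_inv_into)
  have "adjacent G u v \<longleftrightarrow> adjacent H (?f u) (?f v)" if "u \<in> verts G" "v \<in> verts G" for u v
  proof -
    have "?f u < n" "?f v < n" using f that by (auto simp: bij_betw_def)
    moreover have "g (?f u) = u" "g (?f v) = v"
      using g that by (auto intro: bij_betw_inv_into_right)
    ultimately show ?thesis using adj by metis
  qed
  then show "isomorphic G H" unfolding isomorphic_def assms using f by blast
qed

lemma all_less_3: "(\<forall>i<3::nat. P i) \<longleftrightarrow> P 0 \<and> P 1 \<and> P 2"
  by (simp add: All_less_Suc numeral_eq_Suc) blast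

lemma all_less_5: "(\<forall>i<5::nat. P i) \<longleftrightarrow> P 0 \<and> P 1 \<and> P 2 \<and> P 3 \<and> P 4"
  by (simp add: All_less_Suc numeral_eq_Suc) blast

lemma adjacent_path_graph:
  "adjacent (path_graph n) i j \<longleftrightarrow> i < n \<and> j < n \<and> (j = Suc i \<or> i = Suc j)"
  by (auto simp: adjacent_def path_graph_def doubleton_eq_iff)

lemma adjacent_cycle_graph:
  "adjacent (cycle_graph n) i j \<longleftrightarrow>
     i < n \<and> j < n \<and> (j = Suc i mod n \<or> i = Suc j mod n)"
  by (auto simp: adjacent_def cycle_graph_def doubleton_eq_iff)

section \<open>NTD-sets within a set of vertices\<close>

locale finite_simple_graph =
  fixes G :: "'a ugraph"
  assumes simple: "simple_graph G"
begin

abbreviation adj :: "'a \<Rightarrow> 'a \<Rightarrow> bool" (infix "\<sim>" 50) where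
  "u \<sim> v \<equiv> adjacent G u v"

lemma adj_sym: "u \<sim> v \<Longrightarrow> v \<sim> u"
  by (simp add: adjacent_def insert_commute)

lemma adj_irrefl [simp]: "\<not> v \<sim> v"
  using simple by (force simp: adjacent_def simple_graph_def)

lemma adj_verts: "u \<sim> v \<Longrightarrow> u \<in> verts G \<and> v \<in> verts G"
  using simple by (force simp: adjacent_def simple_graph_def)

lemma finite_verts [simp]: "finite (verts G)"
  using simple by (simp add: simple_graph_def)

text \<open>
  If \<open>S\<close> dominates \<open>X\<close>, a vertex \<open>u\<close> of \<open>X\<close> belongs to the open neighbourhood of \<open>S\<close> iff it
  lies outside \<open>S\<close> or is adjacent to a vertex of \<open>S\<close>. The second conjunct therefore says that
  \<open>v\<close> is not isolated in the graph induced by that neighbourhood.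
\<close>

definition secured :: "'a set \<Rightarrow> 'a set \<Rightarrow> 'a \<Rightarrow> bool" where
  "secured X S v \<longleftrightarrow>
     (\<exists>u\<in>S. v \<sim> u) \<and> (\<exists>u\<in>X. v \<sim> u \<and> (u \<notin> S \<or> (\<exists>w\<in>S. u \<sim> w)))"

definition ntd_in :: "'a set \<Rightarrow> 'a set \<Rightarrow> bool" where
  "ntd_in X S \<longleftrightarrow> S \<subseteq> X \<and> (\<forall>v\<in>X - S. secured X S v)"

definition half_secured :: "'a set \<Rightarrow> bool" where
  "half_secured X \<longleftrightarrow> (\<exists>S. ntd_in X S \<and> 2 * card S \<le> card X)"

text \<open>
  Vertices of \<open>S\<close> impose no condition: if \<open>v \<in> S\<close> has a neighbour in \<open>S\<close>, then this neighbour is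
  itself adjacent to \<open>v \<in> S\<close>, so it lies in the open neighbourhood as well.
\<close>

lemma ntd_set_iff: "ntd_set G S \<longleftrightarrow> ntd_in (verts G) S"
proof
  assume L: "ntd_set G S"
  have dom: "S \<subseteq> verts G" "\<forall>v\<in>verts G - S. \<exists>u\<in>S. v \<sim> u"
    using L by (auto simp: ntd_set_def dominating_set_def)
  have "secured (verts G) S v" if v: "v \<in> verts G - S" for v
  proof -
    obtain u where u: "u \<in> S" "v \<sim> u" using dom v by blast
    have "v \<in> open_neighborhood G S"
      using u v adj_sym by (auto simp: open_neighborhood_def neighborhood_def)
    then obtain x where x: "x \<in> open_neighborhood G S" "v \<sim> x"
      using L by (fastforce simp: ntd_set_def no_isolated_vertex_def induced_subgraph_def
          neighborhood_def adjacent_def)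
    then obtain w where "w \<in> S" "w \<sim> x" "x \<in> verts G"
      by (auto simp: open_neighborhood_def neighborhood_def)
    then show ?thesis using u x adj_sym unfolding secured_def by blast
  qed
  with dom show "ntd_in (verts G) S" by (simp add: ntd_in_def)
next
  assume R: "ntd_in (verts G) S"
  have dom: "dominating_set G S"
    using R by (auto simp: ntd_in_def dominating_set_def secured_def)
  have inN: "x \<in> open_neighborhood G S \<longleftrightarrow> (\<exists>w\<in>S. x \<sim> w)" for x
    using adj_sym adj_verts by (auto simp: open_neighborhood_def neighborhood_def)
  have "\<exists>x\<in>open_neighborhood G S. v \<sim> x" if v: "v \<in> open_neighborhood G S" for v
  proof (cases "v \<in> S")
    case True
    then show ?thesis using v inN adj_sym by blast
  next
    case False
    have "v \<in> verts G" using v by (auto simp: open_neighborhood_def neighborhood_def)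
    then obtain u where u: "u \<in> verts G" "v \<sim> u" "u \<notin> S \<or> (\<exists>w\<in>S. u \<sim> w)"
      using False R unfolding ntd_in_def secured_def by blast
    then have "\<exists>w\<in>S. u \<sim> w" using R by (auto simp: ntd_in_def secured_def)
    then show ?thesis using inN u by blast
  qed
  then have "no_isolated_vertex (induced_subgraph G (open_neighborhood G S))"
    by (fastforce simp: no_isolated_vertex_def induced_subgraph_def neighborhood_def adjacent_def
        open_neighborhood_def)
  with dom show "ntd_set G S" by (simp add: ntd_set_def)
qed

lemma ntd_in_refl: "ntd_in X X"
  by (simp add: ntd_in_def)

text \<open>
  The witnesses for a secured vertex survive when \<open>X\<close> and \<open>S\<close> grow, except for one that is used
  because it lies outside \<open>S\<close>. The two compatibility conditions keep these witnesses
  outside the union.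
\<close>

lemma ntd_in_glue:
  assumes "ntd_in X S" "ntd_in Y T" "S \<inter> Y \<subseteq> T" "T \<inter> X \<subseteq> S"
  shows "ntd_in (X \<union> Y) (S \<union> T)"
proof -
  have "secured (X \<union> Y) (S \<union> T) v" if v: "v \<in> X \<union> Y - (S \<union> T)" for v
  proof (cases "v \<in> X")
    case True
    then have "secured X S v" using assms v by (auto simp: ntd_in_def)
    then show ?thesis using assms(4) unfolding secured_def by blast
  next
    case False
    then have "secured Y T v" using assms v by (auto simp: ntd_in_def)
    then show ?thesis using assms(3) unfolding secured_def by blast
  qed
  then show ?thesis using assms by (auto simp: ntd_in_def)
qed

lemma half_secured_union:
  assumes "half_secured X" "half_secured Y" "X \<inter> Y = {}" "finite X" "finite Y"
  shows "half_secured (X \<union> Y)"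
proof -
  obtain S T where *: "ntd_in X S" "2 * card S \<le> card X" "ntd_in Y T" "2 * card T \<le> card Y"
    using assms by (auto simp: half_secured_def)
  then have "S \<subseteq> X" "T \<subseteq> Y" by (auto simp: ntd_in_def)
  then have "ntd_in (X \<union> Y) (S \<union> T)" using ntd_in_glue[OF *(1) *(3)] assms(3) by blast
  moreover have "card (S \<union> T) \<le> card S + card T" by (rule card_Un_le)
  ultimately show ?thesis using * assms card_Un_disjoint[of X Y] unfolding half_secured_def
    by (intro exI[of _ "S \<union> T"]) auto
qed

text \<open>Each vertex outside the pair sees \<open>a\<close> or \<open>b\<close>, and these two vertices are neighbours of each
  other, so both belong to the open neighbourhood.\<close>

lemma adjacent_pair_ntd:
  assumes "a \<sim> b" "a \<in> X" "b \<in> X" "\<forall>v\<in>X - {a, b}. v \<sim> a \<or> v \<sim> b"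
  shows "ntd_in X {a, b}"
  using assms adj_sym unfolding ntd_in_def secured_def by blast

lemma ntd_number_le:
  assumes "ntd_in (verts G) S"
  shows "ntd_number G \<le> card S"
  unfolding ntd_number_def using assms by (intro Least_le) (auto simp: ntd_set_iff)

lemma ntd_number_eqI:
  assumes "ntd_in (verts G) S" "card S = k" "\<And>S. ntd_in (verts G) S \<Longrightarrow> k \<le> card S"
  shows "ntd_number G = k"
  unfolding ntd_number_def using assms by (intro Least_equality) (auto simp: ntd_set_iff)

lemma half_secured_ntd_number:
  assumes "half_secured (verts G)"
  shows "2 * ntd_number G \<le> card (verts G)"
proof -
  obtain S where "ntd_in (verts G) S" "2 * card S \<le> card (verts G)"
    using assms unfolding half_secured_def by blast
  then show ?thesis using ntd_number_le[of S] by simp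
qed

section \<open>Spiders\<close>

text \<open>
  A spider is a spanning subdivided star of \<open>X\<close> with centre \<open>c\<close>; \<open>X\<close> may carry further edges. The
  case without legs is included, so that single vertices and larger spiders are treated
  uniformly as odd branches.
\<close>

inductive spider :: "'a \<Rightarrow> 'a set \<Rightarrow> bool" for c where
  centre: "spider c {c}"
| leg: "\<lbrakk>spider c X; m \<notin> X; l \<notin> X; c \<sim> m; m \<sim> l\<rbrakk> \<Longrightarrow> spider c (insert m (insert l X))"

definition spider_or_edge :: "'a set \<Rightarrow> bool" where
  "spider_or_edge X \<longleftrightarrow> (\<exists>c. spider c X) \<or> (\<exists>a b. a \<sim> b \<and> X = {a, b})"

lemma spider_finite: "spider c X \<Longrightarrow> finite X"
  by (induction rule: spider.induct) auto

lemma spider_or_edge_finite: "spider_or_edge X \<Longrightarrow> finite X"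
  by (auto simp: spider_or_edge_def dest: spider_finite)

text \<open>Separating the middle vertices \<open>M\<close> of the legs from the leaves \<open>L\<close>: either half of a
  spider minus its centre dominates the other half.\<close>

lemma spider_parts:
  assumes "spider c X"
  obtains M L where "X = insert c (M \<union> L)" "c \<notin> M \<union> L" "M \<inter> L = {}"
    "card X = 2 * card M + 1" "card X = 2 * card L + 1"
    "\<forall>m\<in>M. c \<sim> m \<and> (\<exists>l\<in>L. m \<sim> l)" "\<forall>l\<in>L. \<exists>m\<in>M. l \<sim> m"
proof -
  have "\<exists>M L. X = insert c (M \<union> L) \<and> c \<notin> M \<union> L \<and> M \<inter> L = {} \<and>
    card X = 2 * card M + 1 \<and> card X = 2 * card L + 1 \<and>
    (\<forall>m\<in>M. c \<sim> m \<and> (\<exists>l\<in>L. m \<sim> l)) \<and> (\<forall>l\<in>L. \<exists>m\<in>M. l \<sim> m)"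
    using assms
  proof (induction rule: spider.induct)
    case centre
    show ?case by (intro exI[of _ "{}"]) auto
  next
    case (leg X m l)
    then obtain M L where parts: "X = insert c (M \<union> L)" "c \<notin> M \<union> L" "M \<inter> L = {}"
      "card X = 2 * card M + 1" "card X = 2 * card L + 1"
      "\<forall>m\<in>M. c \<sim> m \<and> (\<exists>l\<in>L. m \<sim> l)" "\<forall>l\<in>L. \<exists>m\<in>M. l \<sim> m" by blast
    have fin: "finite X" "finite M" "finite L"
      using spider_finite[OF leg.hyps(1)] parts(1) by auto
    have "m \<noteq> l" using leg.hyps by auto
    then have cX: "card (insert m (insert l X)) = card X + 2" using fin leg.hyps by simp
    have new: "m \<notin> M \<union> L" "l \<notin> M \<union> L" "c \<noteq> m" "c \<noteq> l" using parts(1) leg.hyps by auto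
    show ?case
    proof (rule exI[of _ "insert m M"], rule exI[of _ "insert l L"], intro conjI)
      show "insert m (insert l X) = insert c (insert m M \<union> insert l L)" using parts(1) by auto
      show "c \<notin> insert m M \<union> insert l L" using parts(2) new by auto
      show "insert m M \<inter> insert l L = {}" using parts(3) new \<open>m \<noteq> l\<close> by auto
      show "card (insert m (insert l X)) = 2 * card (insert m M) + 1" using cX parts(4) new fin by simp
      show "card (insert m (insert l X)) = 2 * card (insert l L) + 1" using cX parts(5) new fin by simp
      show "\<forall>m\<in>insert m M. c \<sim> m \<and> (\<exists>l\<in>insert l L. m \<sim> l)" using parts(6) leg.hyps by auto
      show "\<forall>l\<in>insert l L. \<exists>m\<in>insert m M. l \<sim> m" using parts(7) leg.hyps adj_sym by auto
    qed
  qed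
  then show ?thesis using that by blast
qed

text \<open>The legs have no order, so the leg that contains \<open>y\<close> can be taken as the last one added.\<close>

lemma spider_position:
  assumes "spider c X" "y \<in> X" "y \<noteq> c"
  obtains Y m l where "spider c Y" "m \<notin> Y" "l \<notin> Y" "c \<sim> m" "m \<sim> l"
    "X = insert m (insert l Y)" "y = m \<or> y = l"
proof -
  have "\<exists>Y m l. spider c Y \<and> m \<notin> Y \<and> l \<notin> Y \<and> c \<sim> m \<and> m \<sim> l \<and>
    X = insert m (insert l Y) \<and> (y = m \<or> y = l)"
    using assms
  proof (induction rule: spider.induct)
    case centre
    then show ?case by simp
  next
    case (leg X m l)
    show ?case
    proof (cases "y = m \<or> y = l")
      case True
      then show ?thesis using leg.hyps by blast
    next
      case False
      then obtain Y m' l' where *: "spider c Y" "m' \<notin> Y" "l' \<notin> Y" "c \<sim> m'" "m' \<sim> l'"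
        "X = insert m' (insert l' Y)" "y = m' \<or> y = l'" using leg by auto
      have "spider c (insert m (insert l Y))" using * leg.hyps by (intro spider.leg) auto
      then show ?thesis using * leg.hyps
        by (intro exI[of _ "insert m (insert l Y)"] exI[of _ m'] exI[of _ l']) auto
    qed
  qed
  then show ?thesis using that by blast
qed

text \<open>The centre together with the middle vertices works: every other vertex is a leaf, whose
  middle vertex is adjacent to the centre.\<close>

lemma spider_ntd:
  assumes "spider c X" "card X \<noteq> 1"
  obtains S where "ntd_in X S" "2 * card S = card X + 1"
proof -
  obtain M L where parts: "X = insert c (M \<union> L)" "c \<notin> M \<union> L" "M \<inter> L = {}"
    "card X = 2 * card M + 1" "card X = 2 * card L + 1"
    "\<forall>m\<in>M. c \<sim> m \<and> (\<exists>l\<in>L. m \<sim> l)" "\<forall>l\<in>L. \<exists>m\<in>M. l \<sim> m"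
    using spider_parts[OF assms(1)] .
  have "finite M" using spider_finite[OF assms(1)] parts(1) by auto
  then have "2 * card (insert c M) = card X + 1" using parts by auto
  moreover have "ntd_in X (insert c M)"
    unfolding ntd_in_def secured_def using parts(1-3,6,7) adj_sym by blast
  ultimately show ?thesis using that by blast
qed

section \<open>Branches attached to a vertex\<close>

text \<open>
  A spider next to a chosen vertex \<open>r\<close> costs less than half of its vertices, because \<open>r\<close> already
  dominates the vertex \<open>y\<close> at which it is attached. A spider that is a single vertex adds nothing
  to the set, but then its only guaranteed neighbour is \<open>r\<close>, which must not be isolated in \<open>S\<close>;
  this is the hypothesis \<open>free\<close>.
\<close>

lemma attach_spider:
  assumes D: "spider c D" "y \<in> D" "r \<sim> y" and X: "ntd_in X S" "r \<in> S" "D \<inter> X = {}"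
    and free: "card D \<noteq> 1 \<or> (\<exists>w\<in>S. r \<sim> w)"
  obtains T where "T \<subseteq> D" "2 * card T + 1 = card D" "ntd_in (X \<union> D) (S \<union> T)"
proof -
  have SX: "S \<subseteq> X" using X by (simp add: ntd_in_def)
  have rD: "r \<notin> D" "r \<in> X" using X SX by auto
  have fin: "finite D" using D spider_finite by auto
  have *: "ntd_in (X \<union> D) (S \<union> T)" if T: "T \<subseteq> D" "ntd_in (insert r D) (insert r T)" for T
  proof -
    have "ntd_in (X \<union> insert r D) (S \<union> insert r T)"
      by (rule ntd_in_glue[OF X(1) T(2)]) (use X T SX rD in auto)
    then show ?thesis using X rD by (metis Un_insert_right insert_absorb UnI1)
  qed
  show thesis
  proof (cases "card D = 1")
    case True
    then have [simp]: "D = {y}" using D by (auto simp: card_1_singleton_iff)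
    obtain w where w: "w \<in> S" "r \<sim> w" using free True by auto
    have "ntd_in {r, w, y} {r, w}" using D adj_sym w
      by (auto simp: ntd_in_def secured_def)
    then have "ntd_in (X \<union> {r, w, y}) (S \<union> {r, w})"
      by (rule ntd_in_glue[OF X(1)]) (use X w SX in auto)
    moreover have "X \<union> {r, w, y} = X \<union> D" "S \<union> {r, w} = S \<union> {}" using w SX rD X by auto
    ultimately show ?thesis using that[of "{}"] by simp
  next
    case nt: False
    show ?thesis
    proof (cases "y = c")
      case True
      \<comment> \<open>Attached at the centre: take the leaves; the centre, outside the set, helps all middle vertices.\<close>
      obtain M L where parts: "D = insert c (M \<union> L)" "c \<notin> M \<union> L" "M \<inter> L = {}"
        "card D = 2 * card M + 1" "card D = 2 * card L + 1"
        "\<forall>m\<in>M. c \<sim> m \<and> (\<exists>l\<in>L. m \<sim> l)" "\<forall>l\<in>L. \<exists>m\<in>M. l \<sim> m"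
        using spider_parts[OF D(1)] .
      obtain m where m: "m \<in> M" using parts(4) nt by fastforce
      have "ntd_in (insert r D) (insert r L)"
        unfolding ntd_in_def
      proof (intro conjI ballI)
        fix v assume "v \<in> insert r D - insert r L"
        then consider "v = c" | "v \<in> M" using parts(1) by auto
        then show "secured (insert r D) (insert r L) v"
        proof cases
          case 1
          have "c \<sim> r" using D True adj_sym by auto
          moreover have "m \<notin> insert r L" "c \<sim> m" "m \<in> D" using m parts rD by auto
          ultimately show ?thesis unfolding secured_def 1 by blast
        next
          case 2
          have "v \<sim> c" using 2 parts adj_sym by blast
          moreover have "c \<notin> insert r L" "c \<in> D" using parts rD by auto
          ultimately show ?thesis unfolding secured_def using 2 parts(6) by blast
        qed
      qed (use parts in auto)
      moreover have "L \<subseteq> D" using parts by auto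
      ultimately show ?thesis using * that[of L] parts(5) by simp
    next
      case False
      obtain Y m l where Y: "spider c Y" "m \<notin> Y" "l \<notin> Y" "c \<sim> m" "m \<sim> l"
        "D = insert m (insert l Y)" "y = m \<or> y = l"
        using spider_position[OF D(1,2) False] .
      obtain M L where parts: "Y = insert c (M \<union> L)" "c \<notin> M \<union> L" "M \<inter> L = {}"
        "card Y = 2 * card M + 1" "card Y = 2 * card L + 1"
        "\<forall>m\<in>M. c \<sim> m \<and> (\<exists>l\<in>L. m \<sim> l)" "\<forall>l\<in>L. \<exists>m\<in>M. l \<sim> m"
        using spider_parts[OF Y(1)] .
      have finY: "finite Y" "finite M" "finite L" using fin Y(6) parts(1) by auto
      have ml: "m \<noteq> l" "m \<noteq> c" "l \<noteq> c" using Y parts(1) by auto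
      have cD: "card D = card Y + 2" using Y finY ml by simp
      have sym: "m \<sim> c" "l \<sim> m" "y \<sim> r" using Y D adj_sym by auto
      show ?thesis
      proof (cases "y = m")
        case True
        \<comment> \<open>Attached at a middle vertex: take it, so that it is not isolated because of \<open>r\<close>, and
          the leaves of the other legs.\<close>
        have "ntd_in (insert r D) (insert r (insert m L))"
          unfolding ntd_in_def
        proof (intro conjI ballI)
          fix v assume "v \<in> insert r D - insert r (insert m L)"
          then consider "v = c" | "v = l" | "v \<in> M" using parts(1) Y(6) by auto
          then show "secured (insert r D) (insert r (insert m L)) v"
          proof cases
            case 3
            have "v \<sim> c" using 3 parts adj_sym by blast
            moreover have "c \<notin> insert r (insert m L)" "c \<in> D" using parts rD Y ml by auto
            ultimately show ?thesis unfolding secured_def using 3 parts(6) by blast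
          qed (use sym Y True in \<open>auto simp: secured_def\<close>)
        qed (use parts Y in auto)
        moreover have "2 * card (insert m L) + 1 = card D"
          using parts Y finY cD by (auto simp: card_insert_if)
        moreover have "insert m L \<subseteq> D" using parts Y by auto
        ultimately show ?thesis using * that by blast
      next
        case False
        then have yl: "y = l" using Y by auto
        \<comment> \<open>Attached at a leaf: this leg is dominated from both ends, by \<open>r\<close> and by the centre,
          and its two vertices are neighbours outside the set.\<close>
        have "ntd_in (insert r D) (insert r (insert c M))"
          unfolding ntd_in_def
        proof (intro conjI ballI)
          fix v assume "v \<in> insert r D - insert r (insert c M)"
          then consider "v = m" | "v = l" | "v \<in> L" using parts(1) Y(6) by auto
          then show "secured (insert r D) (insert r (insert c M)) v"
          proof cases
            case 1
            have "l \<notin> insert r (insert c M)" "l \<in> D" using parts rD Y ml by auto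
            then show ?thesis unfolding secured_def 1 using sym Y by blast
          next
            case 2
            have "m \<notin> insert r (insert c M)" "m \<in> D" using parts rD Y ml by auto
            then show ?thesis unfolding secured_def 2 using sym Y yl by blast
          next
            case 3
            then obtain u where "u \<in> M" "v \<sim> u" using parts by auto
            moreover have "u \<sim> c" "u \<in> D" using calculation parts Y adj_sym by auto
            ultimately show ?thesis unfolding secured_def by blast
          qed
        qed (use parts Y in auto)
        moreover have "2 * card (insert c M) + 1 = card D"
          using parts Y finY cD by (auto simp: card_insert_if)
        moreover have "insert c M \<subseteq> D" using parts Y by auto
        ultimately show ?thesis using * that by blast
      qed
    qed
  qed
qed

lemma attach_edge:
  assumes D: "D = {m, l}" "m \<sim> l" "r \<sim> m" and X: "ntd_in X S" "r \<in> S" "D \<inter> X = {}"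
  shows "ntd_in (X \<union> D) (insert m S)"
proof -
  have "ntd_in {r, m, l} {r, m}" using D adj_sym by (auto simp: ntd_in_def secured_def)
  then have "ntd_in (X \<union> {r, m, l}) (S \<union> {r, m})"
    by (rule ntd_in_glue[OF X(1)]) (use X D in \<open>auto simp: ntd_in_def\<close>)
  moreover have "X \<union> {r, m, l} = X \<union> D" "S \<union> {r, m} = insert m S"
    using X D by (auto simp: ntd_in_def)
  ultimately show ?thesis by simp
qed

lemma attach_branch:
  assumes D: "spider_or_edge D" "y \<in> D" "r \<sim> y" and X: "ntd_in X S" "r \<in> S" "D \<inter> X = {}" "finite X"
    and free: "card D \<noteq> 1 \<or> (\<exists>w\<in>S. r \<sim> w)"
  obtains T where "S \<subseteq> T" "2 * card T \<le> 2 * card S + card D" "ntd_in (X \<union> D) T"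
proof -
  have "finite S" using X finite_subset by (auto simp: ntd_in_def)
  from D(1) consider c where "spider c D" | a b where "a \<sim> b" "D = {a, b}"
    unfolding spider_or_edge_def by blast
  then show ?thesis
  proof cases
    case 1
    then obtain T where "T \<subseteq> D" "2 * card T + 1 = card D" "ntd_in (X \<union> D) (S \<union> T)"
      using attach_spider[OF _ D(2,3) X(1-3) free] by metis
    then show ?thesis using that[of "S \<union> T"] card_Un_le[of S T] by auto
  next
    case 2
    then obtain m l where "D = {m, l}" "m \<sim> l" "r \<sim> m"
      using D adj_sym by (metis insert_commute insertE singletonD)
    then have "ntd_in (X \<union> D) (insert m S)" "card D = 2"
      using attach_edge X by (auto simp: card_insert_if)
    moreover have "card (insert m S) \<le> Suc (card S)" using \<open>finite S\<close> by (simp add: card_insert_if)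
    ultimately show ?thesis using that[of "insert m S"] by auto
  qed
qed

text \<open>Once a partial set contains \<open>r\<close> and meets the bound, every further branch can be added
  at a cost of at most half of its vertices.\<close>

lemma attach_branches:
  assumes "finite F" "pairwise disjnt F" "\<forall>D\<in>F. spider_or_edge D \<and> (\<exists>y\<in>D. r \<sim> y)"
    and "ntd_in X S" "r \<in> S" "\<Union>F \<inter> X = {}" "finite X" "2 * card S \<le> card X"
    and "(\<forall>D\<in>F. card D \<noteq> 1) \<or> (\<exists>w\<in>S. r \<sim> w)"
  shows "half_secured (X \<union> \<Union>F)"
  using assms
proof (induction F arbitrary: X S rule: finite_induct)
  case empty
  then show ?case by (auto simp: half_secured_def)
next
  case (insert D F)
  obtain y where y: "y \<in> D" "r \<sim> y" "spider_or_edge D" using insert.prems by auto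
  obtain T where T: "S \<subseteq> T" "2 * card T \<le> 2 * card S + card D" "ntd_in (X \<union> D) T"
    using attach_branch[OF y(3,1,2) insert.prems(3,4) _ insert.prems(6)] insert.prems by blast
  have fin: "finite D" using y spider_or_edge_finite by auto
  have "half_secured ((X \<union> D) \<union> \<Union>F)"
  proof (rule insert.IH)
    show "pairwise disjnt F" using insert.prems(1) by (auto simp: pairwise_insert)
    show "\<Union>F \<inter> (X \<union> D) = {}"
      using insert.prems(1,5) insert.hyps(2) by (auto simp: pairwise_insert disjnt_def)
    show "2 * card T \<le> card (X \<union> D)"
      using T insert.prems(5-7) fin by (subst card_Un_disjoint) auto
    show "(\<forall>D\<in>F. card D \<noteq> 1) \<or> (\<exists>w\<in>T. r \<sim> w)" using insert.prems(8) T(1) by auto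
  qed (use insert.prems T fin in auto)
  then show ?case by (simp add: Un_assoc)
qed

lemma legs_spider:
  assumes "finite F" "pairwise disjnt F" "r \<notin> \<Union>F"
    and "\<forall>D\<in>F. \<exists>m l. D = {m, l} \<and> r \<sim> m \<and> m \<sim> l"
  shows "spider r (insert r (\<Union>F))"
  using assms
proof (induction F rule: finite_induct)
  case empty
  then show ?case by (simp add: spider.centre)
next
  case (insert D F)
  then obtain m l where D: "D = {m, l}" "r \<sim> m" "m \<sim> l" by auto
  have "D \<inter> \<Union>F = {}"
    using insert.prems(1) insert.hyps(2) by (auto simp: pairwise_insert disjnt_def)
  moreover have "spider r (insert r (\<Union>F))"
    using insert by (auto simp: pairwise_insert)
  ultimately have "spider r (insert m (insert l (insert r (\<Union>F))))"
    using D insert.prems(2) by (intro spider.leg) auto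
  moreover have "insert m (insert l (insert r (\<Union>F))) = insert r (\<Union>(insert D F))"
    using D by auto
  ultimately show ?case by simp
qed

text \<open>
  This is the one configuration in which a spider and a single vertex \<open>s\<close> at \<open>r\<close> do not allow the
  general construction of \<open>attach_branches\<close>: the path \<open>r s\<close> may be a new leg of the spider, or the
  whole may be a path on five vertices, which is a spider around a former leaf.
\<close>

lemma pendant_edge_on_spider:
  assumes D: "spider c D" "y \<in> D" "r \<sim> y" and rs: "r \<sim> s" "r \<notin> D" "s \<notin> D"
  shows "half_secured (insert r (insert s D)) \<or> spider_or_edge (insert r (insert s D))"
proof (cases "y = c")
  case True
  then have "spider c (insert r (insert s D))"
    using D rs adj_sym by (intro spider.leg) auto
  then show ?thesis by (auto simp: spider_or_edge_def)
next
  case False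
  obtain Y m l where Y: "spider c Y" "m \<notin> Y" "l \<notin> Y" "c \<sim> m" "m \<sim> l"
    "D = insert m (insert l Y)" "y = m \<or> y = l"
    using spider_position[OF D(1,2) False] .
  obtain M L where parts: "Y = insert c (M \<union> L)" "c \<notin> M \<union> L" "M \<inter> L = {}"
    "card Y = 2 * card M + 1" "card Y = 2 * card L + 1"
    "\<forall>m\<in>M. c \<sim> m \<and> (\<exists>l\<in>L. m \<sim> l)" "\<forall>l\<in>L. \<exists>m\<in>M. l \<sim> m"
    using spider_parts[OF Y(1)] .
  have fin: "finite Y" "finite M" "finite L"
    using spider_finite[OF Y(1)] parts(1) by auto
  have neq: "m \<noteq> l" "m \<noteq> c" "l \<noteq> c" "r \<noteq> s" "r \<noteq> c" "s \<noteq> c" "r \<noteq> m" "r \<noteq> l" "s \<noteq> m" "s \<noteq> l"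
    using Y parts(1) rs by auto
  have cD: "card (insert r (insert s D)) = card Y + 4"
    using Y(2,3,6) rs fin neq by simp
  have sym: "m \<sim> c" "l \<sim> m" "y \<sim> r" "s \<sim> r" using Y D rs adj_sym by auto
  show ?thesis
  proof (cases "y = m")
    case True
    \<comment> \<open>Both \<open>r\<close> and \<open>m\<close> are chosen; they are adjacent and serve \<open>s\<close>, \<open>l\<close> and the centre.\<close>
    have "ntd_in (insert r (insert s D)) (insert r (insert m L))"
      unfolding ntd_in_def
    proof (intro conjI ballI)
      fix v assume "v \<in> insert r (insert s D) - insert r (insert m L)"
      then consider "v = c" | "v = l" | "v = s" | "v \<in> M" using parts(1) Y(6) by auto
      then show "secured (insert r (insert s D)) (insert r (insert m L)) v"
      proof cases
        case 4
        have "v \<sim> c" using 4 parts adj_sym by blast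
        moreover have "c \<notin> insert r (insert m L)" "c \<in> D" using parts Y neq by auto
        ultimately show ?thesis unfolding secured_def using 4 parts(6) by blast
      qed (use sym Y True D in \<open>auto simp: secured_def\<close>)
    qed (use parts Y in auto)
    moreover have "card (insert r (insert m L)) \<le> card L + 2"
      using fin by (simp add: card_insert_if)
    ultimately have "half_secured (insert r (insert s D))"
      unfolding half_secured_def using cD parts(5) by (intro exI[of _ "insert r (insert m L)"]) simp
    then show ?thesis ..
  next
    case False
    then have yl: "y = l" using Y by auto
    show ?thesis
    proof (cases "M = {}")
      case True
      \<comment> \<open>The path \<open>s r l m c\<close> is a spider with centre \<open>l\<close>.\<close>
      then have "Y = {c}" using parts by (auto simp: card_eq_0_iff fin)
      have "spider l (insert r (insert s (insert m (insert c {l}))))"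
        by (intro spider.leg spider.centre) (use sym yl rs neq in auto)
      moreover have "insert r (insert s (insert m (insert c {l}))) = insert r (insert s D)"
        using \<open>Y = {c}\<close> Y by auto
      ultimately show ?thesis unfolding spider_or_edge_def by metis
    next
      case False
      \<comment> \<open>With \<open>s\<close> and \<open>m\<close> chosen on the path \<open>s r l m c\<close>, each of \<open>r\<close> and \<open>l\<close> has one chosen
        neighbour and the other one as a neighbour outside the set; the centre needs the middle vertex \<open>m'\<close> of another leg as a neighbour outside the set.\<close>
      then obtain m' where m': "m' \<in> M" by auto
      have "ntd_in (insert r (insert s D)) (insert s (insert m L))"
        unfolding ntd_in_def
      proof (intro conjI ballI)
        let ?S = "insert s (insert m L)"
        fix v assume "v \<in> insert r (insert s D) - insert s (insert m L)"
        then consider "v = c" | "v = l" | "v = r" | "v \<in> M" using parts(1) Y(6) by auto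
        then show "secured (insert r (insert s D)) ?S v"
        proof cases
          case 1
          have "m' \<notin> ?S" "m' \<in> D" "c \<sim> m'" using m' parts Y rs by auto
          then show ?thesis unfolding secured_def 1 using Y by blast
        next
          case 2
          have "r \<notin> ?S" using parts Y rs neq by auto
          then show ?thesis unfolding secured_def 2 using sym yl by blast
        next
          case 3
          have "l \<notin> ?S" "l \<in> D" using parts Y rs neq by auto
          then show ?thesis unfolding secured_def 3 using D yl rs by blast
        next
          case 4
          have "v \<sim> c" using 4 parts adj_sym by blast
          moreover have "c \<notin> ?S" "c \<in> D" using parts Y neq by auto
          ultimately show ?thesis unfolding secured_def using 4 parts(6) by blast
        qed
      qed (use parts Y in auto)
      moreover have "card (insert s (insert m L)) \<le> card L + 2"
        using fin by (simp add: card_insert_if)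
      ultimately have "half_secured (insert r (insert s D))"
        unfolding half_secured_def using cD parts(5) by (intro exI[of _ "insert s (insert m L)"]) simp
      then show ?thesis ..
    qed
  qed
qed

text \<open>
  The cases are governed by the surplus \<open>card X - 2 * card S\<close>. The set \<open>{r}\<close> alone has surplus
  \<open>-1\<close>; attaching a spider adds 1, attaching an edge adds 0. Hence one spider suffices unless a
  single-vertex branch requires that \<open>r\<close> gets a chosen neighbour. An edge branch provides this neighbour
  for free. Without edge branches a single vertex \<open>s\<close> itself is chosen, which lowers the surplus by 2
  compared with attaching \<open>s\<close>, so two further spiders are needed. The exceptions are: no spiders
  (then \<open>r\<close> is the centre of a spider), only \<open>s\<close> (an edge), and \<open>s\<close> with one spider
  (\<open>pendant_edge_on_spider\<close>).
\<close>

lemma hub_dichotomy: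
  assumes F: "finite F" "pairwise disjnt F" "r \<notin> \<Union>F"
    and branch: "\<forall>D\<in>F. spider_or_edge D \<and> (\<exists>y\<in>D. r \<sim> y)"
  shows "half_secured (insert r (\<Union>F)) \<or> spider_or_edge (insert r (\<Union>F))"
proof -
  have disj: "D \<inter> E = {}" if "D \<in> F" "E \<in> F" "D \<noteq> E" for D E
    using F(2) that by (auto simp: pairwise_def disjnt_def)
  have finD: "finite D" if "D \<in> F" for D using branch that spider_or_edge_finite by auto
  have edge: "\<exists>m l. D = {m, l} \<and> r \<sim> m \<and> m \<sim> l" if D: "D \<in> F" "\<nexists>c. spider c D" for D
  proof -
    obtain y a b where "y \<in> D" "r \<sim> y" "a \<sim> b" "D = {a, b}"
      using branch D unfolding spider_or_edge_def by blast
    then show ?thesis using adj_sym by (metis insert_commute insertE singletonD)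
  qed
  have rest: "half_secured (insert r (\<Union>F))"
    if "K \<subseteq> F" "ntd_in (insert r (\<Union>K)) S" "r \<in> S" "2 * card S \<le> card (insert r (\<Union>K))"
      "(\<forall>D\<in>F. card D \<noteq> 1) \<or> (\<exists>w\<in>S. r \<sim> w)" for K S
  proof -
    have "finite K" using F(1) that(1) finite_subset by blast
    then have "finite (insert r (\<Union>K))" using finD that(1) by blast
    have "half_secured (insert r (\<Union>K) \<union> \<Union>(F - K))"
    proof (rule attach_branches[where r = r and S = S])
      show "pairwise disjnt (F - K)" using F(2) by (rule pairwise_subset) auto
      show "\<forall>D\<in>F - K. spider_or_edge D \<and> (\<exists>y\<in>D. r \<sim> y)" using branch by blast
      show "\<Union>(F - K) \<inter> insert r (\<Union>K) = {}" using F(3) disj that(1) by blast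
      show "(\<forall>D\<in>F - K. card D \<noteq> 1) \<or> (\<exists>w\<in>S. r \<sim> w)" using that(5) by blast
    qed (use F(1) that \<open>finite (insert r (\<Union>K))\<close> in simp_all)
    moreover have "insert r (\<Union>K) \<union> \<Union>(F - K) = insert r (\<Union>F)" using that(1) by auto
    ultimately show ?thesis by simp
  qed
  show ?thesis
  proof (cases "\<exists>D\<in>F. \<exists>c. spider c D")
    case False
    then have "spider r (insert r (\<Union>F))"
      using edge by (intro legs_spider F) blast
    then show ?thesis by (auto simp: spider_or_edge_def)
  next
    case True
    then obtain D c y where D: "D \<in> F" "spider c D" "y \<in> D" "r \<sim> y" using branch by blast
    have rD: "r \<notin> D" using D F by auto
    show ?thesis
    proof (cases "\<exists>E\<in>F. \<nexists>c. spider c E")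
      case True
      then obtain E m l where E: "E \<in> F" "E = {m, l}" "r \<sim> m" "m \<sim> l" "E \<noteq> D"
        using edge D by blast
      have rE: "r \<notin> E" using E F by auto
      have "ntd_in ({r} \<union> E) (insert m {r})"
        using E rE by (intro attach_edge) (auto simp: ntd_in_refl)
      then obtain T where T: "T \<subseteq> D" "2 * card T + 1 = card D"
        "ntd_in (({r} \<union> E) \<union> D) (insert m {r} \<union> T)"
        using attach_spider[OF D(2-4), of "{r} \<union> E" "insert m {r}"] E disj[OF D(1) E(1)] rD by auto
      have "card (({r} \<union> E) \<union> D) = 3 + card D"
      proof -
        have "card ({r} \<union> E) = 3" using E rE by (auto simp: card_insert_if)
        then show ?thesis using disj[OF D(1) E(1)] E rD finD[OF D(1)] finD[OF E(1)]
          by (subst card_Un_disjoint) auto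
      qed
      moreover have "card (insert m {r} \<union> T) \<le> 2 + card T"
        using card_Un_le[of "insert m {r}" T] by (auto simp: card_insert_if split: if_splits)
      moreover have "({r} \<union> E) \<union> D = insert r (\<Union>{E, D})" by auto
      ultimately have "half_secured (insert r (\<Union>F))"
        using T E D by (intro rest[of "{E, D}" "insert m {r} \<union> T"]) auto
      then show ?thesis ..
    next
      case False
      then have spiders: "\<exists>c. spider c E" if "E \<in> F" for E using that by auto
      show ?thesis
      proof (cases "\<exists>E\<in>F. card E = 1")
        case False
        obtain T where T: "T \<subseteq> D" "2 * card T + 1 = card D" "ntd_in ({r} \<union> D) ({r} \<union> T)"
          using attach_spider[OF D(2-4), of "{r}" "{r}"] rD False D by (auto simp: ntd_in_refl)
        have "card (insert r D) = 1 + card D" using rD finD[OF D(1)] by simp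
        moreover have "card ({r} \<union> T) \<le> 1 + card T" using card_Un_le[of "{r}" T] by simp
        ultimately have "half_secured (insert r (\<Union>F))"
          using T D False by (intro rest[of "{D}" "{r} \<union> T"]) auto
        then show ?thesis ..
      next
        case True
        then obtain s where s: "{s} \<in> F" "r \<sim> s" using branch by (metis card_1_singletonE singletonD)
        have rs: "r \<noteq> s" using s by auto
        consider "F = {{s}}" | E where "F = {{s}, E}" "E \<noteq> {s}"
          | E E' where "E \<in> F" "E' \<in> F" "E \<noteq> E'" "E \<noteq> {s}" "E' \<noteq> {s}"
          using s(1) by blast
        then show ?thesis
        proof cases
          case 1
          then have "insert r (\<Union>F) = {r, s}" by auto
          then show ?thesis using s(2) unfolding spider_or_edge_def by blast
        next
          case 2
          then have E: "E \<in> F" by simp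
          obtain c y where E': "spider c E" "y \<in> E" "r \<sim> y" using spiders[OF E] branch E by blast
          have "s \<notin> E" "r \<notin> E" using disj[OF s(1) E] 2 F(3) E by auto
          then have "half_secured (insert r (insert s E)) \<or> spider_or_edge (insert r (insert s E))"
            using pendant_edge_on_spider[OF E' s(2)] by blast
          moreover have "insert r (\<Union>F) = insert r (insert s E)" using 2 by auto
          ultimately show ?thesis by simp
        next
          case 3
          obtain c y where E: "spider c E" "y \<in> E" "r \<sim> y" using spiders branch 3 by blast
          obtain c' y' where E': "spider c' E'" "y' \<in> E'" "r \<sim> y'" using spiders branch 3 by blast
          have dis: "s \<notin> E" "r \<notin> E" "s \<notin> E'" "r \<notin> E'" "E \<inter> E' = {}"
            using disj[OF s(1)] disj[of E E'] 3 F(3) by auto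
          obtain T where T: "T \<subseteq> E" "2 * card T + 1 = card E" "ntd_in ({r,s} \<union> E) ({r,s} \<union> T)"
            using attach_spider[OF E, of "{r, s}" "{r, s}"] dis s by (auto simp: ntd_in_refl)
          obtain T' where T': "T' \<subseteq> E'" "2 * card T' + 1 = card E'"
            "ntd_in (({r,s} \<union> E) \<union> E') (({r,s} \<union> T) \<union> T')"
            using attach_spider[OF E', of "{r, s} \<union> E" "{r, s} \<union> T"] dis s T by auto
          have "card (({r,s} \<union> E) \<union> E') = 2 + card E + card E'"
          proof -
            have "card ({r,s} \<union> E) = 2 + card E"
              using dis finD 3 rs by (subst card_Un_disjoint) auto
            then show ?thesis using dis finD 3 by (subst card_Un_disjoint) auto
          qed
          moreover have "card (({r,s} \<union> T) \<union> T') \<le> 2 + card T + card T'"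
            using card_Un_le[of "{r,s} \<union> T" T'] card_Un_le[of "{r,s}" T] rs by simp
          moreover have "({r,s} \<union> E) \<union> E' = insert r (\<Union>{{s}, E, E'})" by auto
          ultimately have "half_secured (insert r (\<Union>F))"
            using T T' 3 s by (intro rest[of "{{s}, E, E'}" "({r,s} \<union> T) \<union> T'"]) auto
          then show ?thesis ..
        qed
      qed
    qed
  qed
qed

section \<open>Connected sets of vertices\<close>

text \<open>Connectivity is expressed by cuts: no proper part of \<open>X\<close> is separated from the rest. Unions
  and maximal connected subsets are easier to treat in this form than with walks.\<close>

definition connected_set :: "'a set \<Rightarrow> bool" where
  "connected_set X \<longleftrightarrow> X \<noteq> {} \<and> (\<forall>Y\<subseteq>X. Y \<noteq> {} \<and> Y \<noteq> X \<longrightarrow> (\<exists>u\<in>Y. \<exists>v\<in>X - Y. u \<sim> v))"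

lemma connected_set_singleton: "connected_set {v}"
  by (auto simp: connected_set_def)

lemma connected_set_union:
  assumes "connected_set A" "connected_set B" and ab: "A \<inter> B \<noteq> {} \<or> (\<exists>a\<in>A. \<exists>b\<in>B. a \<sim> b)"
  shows "connected_set (A \<union> B)"
  unfolding connected_set_def
proof (intro conjI allI impI)
  show "A \<union> B \<noteq> {}" using assms by (auto simp: connected_set_def)
  fix Y assume Y: "Y \<subseteq> A \<union> B" "Y \<noteq> {} \<and> Y \<noteq> A \<union> B"
  show "\<exists>u\<in>Y. \<exists>v\<in>A \<union> B - Y. u \<sim> v"
  proof (cases "(Y \<inter> A \<noteq> {} \<and> Y \<inter> A \<noteq> A) \<or> (Y \<inter> B \<noteq> {} \<and> Y \<inter> B \<noteq> B)")
    case True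
    then show ?thesis
    proof
      assume "Y \<inter> A \<noteq> {} \<and> Y \<inter> A \<noteq> A"
      then have "\<exists>u\<in>Y \<inter> A. \<exists>v\<in>A - Y \<inter> A. u \<sim> v" using assms(1) unfolding connected_set_def by blast
      then show ?thesis by blast
    next
      assume "Y \<inter> B \<noteq> {} \<and> Y \<inter> B \<noteq> B"
      then have "\<exists>u\<in>Y \<inter> B. \<exists>v\<in>B - Y \<inter> B. u \<sim> v" using assms(2) unfolding connected_set_def by blast
      then show ?thesis by blast
    qed
  next
    case False
    then consider "Y = A" "A \<inter> B = {}" | "Y = B" "A \<inter> B = {}" using Y by blast
    then show ?thesis
    proof cases
      case 1
      then show ?thesis using ab by blast
    next
      case 2
      then obtain a b where "a \<in> A" "b \<in> B" "b \<sim> a" using ab adj_sym by blast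
      then show ?thesis using 2 by blast
    qed
  qed
qed

lemma connected_set_star:
  assumes "finite F" "connected_set X" "r \<in> X" "\<forall>D\<in>F. connected_set D \<and> (\<exists>y\<in>D. r \<sim> y)"
  shows "connected_set (X \<union> \<Union>F)"
  using assms(1,4)
proof (induction F rule: finite_induct)
  case empty
  then show ?case using assms by simp
next
  case (insert D F)
  have "\<forall>D\<in>F. connected_set D \<and> (\<exists>y\<in>D. r \<sim> y)" using insert.prems by (meson insertCI)
  then have 1: "connected_set (X \<union> \<Union>F)" by (rule insert.IH)
  have D: "connected_set D" "\<exists>y\<in>D. r \<sim> y" using insert.prems by (meson insertI1)+
  have "\<exists>a\<in>X \<union> \<Union>F. \<exists>b\<in>D. a \<sim> b" using D(2) assms(3) by (meson UnI1)
  then have "connected_set ((X \<union> \<Union>F) \<union> D)" using connected_set_union[OF 1 D(1)] by blast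
  moreover have "(X \<union> \<Union>F) \<union> D = X \<union> \<Union>(insert D F)" by auto
  ultimately show ?case by simp
qed

text \<open>The family consists of the maximal connected subsets of \<open>C - {r}\<close>. Maximality rules out an
  edge from such a set to any vertex other than \<open>r\<close>, so the cut condition of \<open>C\<close> gives an
  edge to \<open>r\<close>.\<close>

lemma components:
  assumes C: "connected_set C" "finite C" "r \<in> C"
  obtains F where "finite F" "pairwise disjnt F" "\<Union>F = C - {r}"
    "\<forall>D\<in>F. connected_set D \<and> (\<exists>y\<in>D. r \<sim> y)"
proof -
  define K where "K = {D. connected_set D \<and> D \<subseteq> C - {r}}"
  define F where "F = {D\<in>K. \<forall>E\<in>K. D \<subseteq> E \<longrightarrow> D = E}"
  have finK: "finite K" unfolding K_def by (rule finite_subset[of _ "Pow C"]) (use C in auto)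
  have "finite F" unfolding F_def using finK by simp
  moreover have "pairwise disjnt F"
  proof (rule pairwiseI)
    fix D E assume DE: "D \<in> F" "E \<in> F" "D \<noteq> E"
    show "disjnt D E"
    proof (rule ccontr)
      assume "\<not> disjnt D E"
      then have "connected_set (D \<union> E)"
        using DE by (intro connected_set_union) (simp_all add: F_def K_def disjnt_def)
      then have "D \<union> E \<in> K" using DE by (simp add: F_def K_def)
      then have "D = D \<union> E" "E = D \<union> E" using DE(1,2) by (simp_all add: F_def)
      then show False using DE(3) by simp
    qed
  qed
  moreover have "\<Union>F = C - {r}"
  proof
    show "\<Union>F \<subseteq> C - {r}" by (auto simp: F_def K_def)
    show "C - {r} \<subseteq> \<Union>F"
    proof
      fix v assume "v \<in> C - {r}"
      then have "{v} \<in> K" by (simp add: K_def connected_set_singleton)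
      then obtain D where "D \<in> K" "{v} \<subseteq> D" "\<forall>E\<in>K. D \<subseteq> E \<longrightarrow> D = E"
        using finite_has_maximal2[OF finK] by blast
      then show "v \<in> \<Union>F" unfolding F_def by blast
    qed
  qed
  moreover have "\<forall>D\<in>F. connected_set D \<and> (\<exists>y\<in>D. r \<sim> y)"
  proof
    fix D assume D: "D \<in> F"
    have DK: "connected_set D" "D \<subseteq> C - {r}" using D by (auto simp: F_def K_def)
    then have "D \<noteq> C" "D \<noteq> {}" using C(3) by (auto simp: connected_set_def)
    then obtain u v where uv: "u \<in> D" "v \<in> C - D" "u \<sim> v"
      using C(1) DK(2) unfolding connected_set_def by blast
    have "v = r"
    proof (rule ccontr)
      assume "v \<noteq> r"
      moreover have "connected_set (D \<union> {v})" using uv DK by (intro connected_set_union connected_set_singleton) auto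
      ultimately have "D \<union> {v} \<in> K" using uv DK by (auto simp: K_def)
      then have "D = D \<union> {v}" using D by (simp add: F_def subset_insertI)
      then show False using uv(2) by blast
    qed
    then show "connected_set D \<and> (\<exists>y\<in>D. r \<sim> y)" using uv DK(1) adj_sym by blast
  qed
  ultimately show ?thesis by (rule that)
qed

text \<open>
  By induction no two complementary connected parts of a counterexample can both avoid being spider
  or edge. The required hub is then found by descent. Take a smallest connected part \<open>C\<close> with connected
  complement that is neither spider nor edge, and let \<open>r\<close> be a vertex of \<open>C\<close> with a neighbour
  outside. A component of \<open>C - {r}\<close> again has a connected complement and is
  smaller, so it is a spider or an edge, and so is \<open>X - C\<close>. If there is no such \<open>C\<close>, any vertex
  \<open>r\<close> is a hub.
\<close>

lemma connected_set_dichotomy: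
  assumes "finite X" "connected_set X"
  shows "half_secured X \<or> spider_or_edge X"
  using assms
proof (induction "card X" arbitrary: X rule: less_induct)
  case less
  show ?case
  proof (rule ccontr)
    assume neither: "\<not> (half_secured X \<or> spider_or_edge X)"
    have split: "spider_or_edge (X - C)"
      if C: "C \<subseteq> X" "C \<noteq> X" "connected_set C" "connected_set (X - C)" "\<not> spider_or_edge C"
      for C
    proof (rule ccontr)
      assume nb: "\<not> spider_or_edge (X - C)"
      have "finite C" "C \<noteq> {}" using C less.prems finite_subset by (auto simp: connected_set_def)
      then have "card C < card X" "card (X - C) < card X"
        using C less.prems by (auto intro!: psubset_card_mono)
      then have "half_secured C" "half_secured (X - C)"
        using less.hyps C less.prems nb \<open>finite C\<close> by auto
      then have "half_secured (C \<union> (X - C))"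
        using \<open>finite C\<close> less.prems by (intro half_secured_union) auto
      then show False using neither C(1) by (simp add: Un_absorb1)
    qed
    have hub: False if "finite F" "pairwise disjnt F" "\<Union>F = X - {r}" "r \<in> X"
      "\<forall>D\<in>F. spider_or_edge D \<and> (\<exists>y\<in>D. r \<sim> y)" for F r
    proof -
      have "insert r (\<Union>F) = X" using that by auto
      then show False using hub_dichotomy[of F r] that neither by auto
    qed
    show False
    proof (cases "\<exists>C. C \<subseteq> X \<and> C \<noteq> X \<and> connected_set C \<and> connected_set (X - C) \<and> \<not> spider_or_edge C")
      case False
      obtain r where r: "r \<in> X" using less.prems by (auto simp: connected_set_def)
      obtain F where F: "finite F" "pairwise disjnt F" "\<Union>F = X - {r}"
        "\<forall>D\<in>F. connected_set D \<and> (\<exists>y\<in>D. r \<sim> y)"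
        using components[OF less.prems(2,1) r] .
      have "spider_or_edge D" if D: "D \<in> F" for D
      proof -
        have "connected_set ({r} \<union> \<Union>(F - {D}))" using F by (intro connected_set_star connected_set_singleton) auto
        moreover have "{r} \<union> \<Union>(F - {D}) = X - D"
          using F(2,3) r D by (auto simp: pairwise_def disjnt_def)
        moreover have "D \<subseteq> X" "D \<noteq> X" "connected_set D" using F(3,4) r D by blast+
        ultimately show ?thesis using False by metis
      qed
      then show False using hub[OF F(1-3) r] F(4) by blast
    next
      case True
      define P where "P C \<longleftrightarrow> C \<subseteq> X \<and> C \<noteq> X \<and> connected_set C \<and> connected_set (X - C) \<and> \<not> spider_or_edge C" for C
      obtain C0 where "P C0" using True unfolding P_def by blast
      then obtain C where "P C" and min': "\<And>D. P D \<Longrightarrow> card C \<le> card D"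
        using ex_has_least_nat[of P C0 card] by blast
      then have C: "C \<subseteq> X" "C \<noteq> X" "connected_set C" "connected_set (X - C)" "\<not> spider_or_edge C"
        by (simp_all add: P_def)
      have min: "card C \<le> card D"
        if "D \<subseteq> X" "D \<noteq> X" "connected_set D" "connected_set (X - D)" "\<not> spider_or_edge D" for D
        using min' that by (simp add: P_def)
      have "C \<noteq> {}" using C(3) by (auto simp: connected_set_def)
      then obtain r y where ry: "r \<in> C" "y \<in> X - C" "r \<sim> y"
        using less.prems(2) C(1,2) unfolding connected_set_def by blast
      have finC: "finite C" using C less.prems finite_subset by blast
      obtain F where F: "finite F" "pairwise disjnt F" "\<Union>F = C - {r}"
        "\<forall>D\<in>F. connected_set D \<and> (\<exists>y\<in>D. r \<sim> y)"
        using components[OF C(3) finC ry(1)] .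
      have "spider_or_edge D" if D: "D \<in> F" for D
      proof (rule ccontr)
        assume nb: "\<not> spider_or_edge D"
        have "connected_set ({r} \<union> (X - C))" using C ry by (intro connected_set_union connected_set_singleton) auto
        then have "connected_set (({r} \<union> (X - C)) \<union> \<Union>(F - {D}))"
          using F by (intro connected_set_star[where r = r]) auto
        moreover have "({r} \<union> (X - C)) \<union> \<Union>(F - {D}) = X - D"
        proof -
          have "D \<subseteq> C - {r}" "D \<inter> \<Union>(F - {D}) = {}" "\<Union>F = D \<union> \<Union>(F - {D})"
            using F(2,3) D by (auto simp: pairwise_def disjnt_def)
          moreover from this(1,2) have "X - D = (X - C) \<union> (C - D)" using C(1) by blast
          moreover have "C = {r} \<union> (D \<union> \<Union>(F - {D}))" using calculation(3) F(3) ry(1) by auto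
          ultimately show ?thesis by blast
        qed
        ultimately have "connected_set (X - D)" by simp
        moreover have "D \<subset> C" using D F(3) ry(1) by blast
        ultimately have "card C \<le> card D" using C(1,2) F(4) D nb by (intro min) auto
        then show False using psubset_card_mono[OF finC \<open>D \<subset> C\<close>] by simp
      qed
      then have bads: "\<forall>D\<in>insert (X - C) F. spider_or_edge D \<and> (\<exists>y\<in>D. r \<sim> y)"
        using split[OF C] ry(2,3) F(4) by (metis insert_iff)
      have "pairwise disjnt (insert (X - C) F)"
        using F(2,3) by (auto simp: pairwise_insert disjnt_def)
      moreover have "\<Union>(insert (X - C) F) = X - {r}" using F(3) C(1) ry(1) by auto
      moreover have "r \<in> X" using ry(1) C(1) by blast
      ultimately show False using hub[OF _ _ _ _ bads] F(1) by simp
    qed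
  qed
qed

lemma connected_graph_connected_set:
  assumes "connected_graph G"
  shows "connected_set (verts G)"
  unfolding connected_set_def
proof (intro conjI allI impI)
  show "verts G \<noteq> {}" using assms by (simp add: connected_graph_def)
  fix Y assume Y: "Y \<subseteq> verts G" "Y \<noteq> {} \<and> Y \<noteq> verts G"
  then obtain u v where uv: "u \<in> Y" "v \<in> verts G - Y" by blast
  then have "(adjacent G)\<^sup>*\<^sup>* u v" using assms Y(1) by (auto simp: connected_graph_def)
  then show "\<exists>u\<in>Y. \<exists>v\<in>verts G - Y. u \<sim> v"
    using uv
  proof (induction rule: converse_rtranclp_induct)
    case base
    then show ?case by simp
  next
    case (step u w)
    then show ?case using adj_verts by blast
  qed
qed

section \<open>Matchings\<close>

lemma finite_edges: "finite (edges G)"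
proof (rule finite_subset)
  show "edges G \<subseteq> Pow (verts G)" using simple by (auto simp: simple_graph_def)
qed simp

lemma matching_card_le:
  assumes "matching G M"
  shows "card M \<le> matching_number G"
  unfolding matching_number_def
proof (rule Max_ge)
  have "{M. matching G M} \<subseteq> Pow (edges G)" by (auto simp: matching_def)
  then show "finite (card ` {M. matching G M})" using finite_edges finite_subset by blast
qed (use assms in auto)

lemma matching_twice_card:
  assumes "matching G M"
  shows "2 * card M = card (\<Union>M)"
proof -
  have M: "M \<subseteq> edges G" "pairwise disjnt M" using assms by (auto simp: matching_def)
  have two: "card e = 2" if "e \<in> M" for e using M(1) that simple by (auto simp: simple_graph_def)
  have "card (\<Union>M) = sum card M"
    using M(2) two by (intro card_Union_disjoint) (auto simp: card_ge_0_finite)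
  also have "\<dots> = 2 * card M" using two by simp
  finally show ?thesis by simp
qed

lemma twice_matching_number_le: "2 * matching_number G \<le> card (verts G)"
proof -
  have "{M. matching G M} \<subseteq> Pow (edges G)" by (auto simp: matching_def)
  then have "finite (card ` {M. matching G M})" using finite_edges finite_subset by blast
  moreover have "matching G {}" by (simp add: matching_def)
  ultimately have "matching_number G \<in> card ` {M. matching G M}"
    unfolding matching_number_def by (intro Max_in) auto
  then obtain M where M: "matching G M" "matching_number G = card M" by auto
  have "\<Union>M \<subseteq> verts G" using M(1) simple by (auto simp: matching_def simple_graph_def)
  then have "card (\<Union>M) \<le> card (verts G)" by (intro card_mono) auto
  then show ?thesis using matching_twice_card[OF M(1)] M(2) by simp
qed

definition near_matched :: "'a set \<Rightarrow> bool" where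
  "near_matched X \<longleftrightarrow> (\<exists>M. matching G M \<and> \<Union>M \<subseteq> X \<and> card X \<le> 2 * card M + 1)"

lemma near_matched_add_edge:
  assumes "near_matched X" "finite X" "a \<notin> X" "b \<notin> X" "a \<sim> b"
  shows "near_matched (insert a (insert b X))"
proof -
  obtain M where M: "matching G M" "\<Union>M \<subseteq> X" "card X \<le> 2 * card M + 1"
    using assms(1) unfolding near_matched_def by blast
  have "matching G (insert {a, b} M)"
    using M(1,2) assms(3-5)
    by (auto simp: matching_def pairwise_insert disjnt_def adjacent_def)
  moreover have "{a, b} \<notin> M" using M(2) assms(3) by auto
  moreover have "finite M" using M(1) finite_edges finite_subset by (auto simp: matching_def)
  moreover have "a \<noteq> b" using assms(5) by auto
  ultimately show ?thesis
    unfolding near_matched_def using M(2,3) assms(2-4)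
    by (intro exI[of _ "insert {a, b} M"]) auto
qed

lemma near_matched_small:
  assumes "card X \<le> 1"
  shows "near_matched X"
  unfolding near_matched_def using assms by (intro exI[of _ "{}"]) (auto simp: matching_def)

lemma spider_near_matched: "spider c X \<Longrightarrow> near_matched X"
proof (induction rule: spider.induct)
  case centre
  then show ?case by (simp add: near_matched_small)
next
  case (leg X m l)
  then show ?case using spider_finite by (intro near_matched_add_edge) auto
qed

definition path_on :: "(nat \<Rightarrow> 'a) \<Rightarrow> nat \<Rightarrow> bool" where
  "path_on g n \<longleftrightarrow> inj_on g {..<n} \<and> (\<forall>i. Suc i < n \<longrightarrow> g i \<sim> g (Suc i))"

text \<open>Peeling off the last two vertices leaves at most one vertex unmatched.\<close>

lemma path_near_matched: "path_on g n \<Longrightarrow> near_matched (g ` {..<n})"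
proof (induction n rule: nat_induct2)
  case (step n)
  have *: "g ` {..<n + 2} = insert (g n) (insert (g (Suc n)) (g ` {..<n}))"
    by (auto simp: lessThan_Suc)
  have "path_on g n" using step.prems by (auto simp: path_on_def inj_on_def)
  then have "near_matched (g ` {..<n})" by (rule step.IH)
  moreover have inj: "inj_on g {..<n + 2}" and "g n \<sim> g (Suc n)"
    using step.prems by (auto simp: path_on_def)
  moreover have "g n \<notin> g ` {..<n}" "g (Suc n) \<notin> g ` {..<n}"
    by (subst inj_on_image_mem_iff[OF inj]; auto)+
  ultimately show ?case unfolding * by (intro near_matched_add_edge) auto
qed (simp_all add: near_matched_small lessThan_Suc)

lemma near_matched_family:
  assumes "finite F" "pairwise disjnt F" "\<forall>X\<in>F. finite X \<and> near_matched X"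
  shows "\<exists>M. matching G M \<and> \<Union>M \<subseteq> \<Union>F \<and> card (\<Union>F) \<le> 2 * card M + card F"
  using assms
proof (induction F rule: finite_induct)
  case empty
  then show ?case by (intro exI[of _ "{}"]) (auto simp: matching_def)
next
  case (insert X F)
  then obtain M where M: "matching G M" "\<Union>M \<subseteq> \<Union>F" "card (\<Union>F) \<le> 2 * card M + card F"
    by (auto simp: pairwise_insert)
  obtain N where N: "matching G N" "\<Union>N \<subseteq> X" "card X \<le> 2 * card N + 1"
    using insert.prems unfolding near_matched_def by blast
  have disj: "X \<inter> \<Union>F = {}"
    using insert.prems(1) insert.hyps(2) by (auto simp: pairwise_insert disjnt_def)
  have fin: "finite M" "finite N" "finite X" "finite (\<Union>F)"
    using M N insert finite_edges finite_subset by (auto simp: matching_def)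
  have "{} \<notin> M" using M(1) simple by (force simp: matching_def simple_graph_def)
  moreover have "e = {}" if "e \<in> M" "e \<in> N" for e
    using that M(2) N(2) disj by blast
  ultimately have "M \<inter> N = {}" by blast
  have "disjnt d e" if "d \<in> M" "e \<in> N" for d e
    using that M(2) N(2) disj unfolding disjnt_def by blast
  then have "pairwise disjnt (M \<union> N)"
    using M(1) N(1) unfolding matching_def pairwise_def by (metis Un_iff disjnt_sym)
  then have "matching G (M \<union> N)" using M(1) N(1) by (simp add: matching_def)
  moreover have "card (M \<union> N) = card M + card N" using fin \<open>M \<inter> N = {}\<close> by (intro card_Un_disjoint)
  moreover have "card (\<Union>(insert X F)) = card X + card (\<Union>F)"
    using card_Un_disjoint[OF fin(3,4) disj] by simp
  ultimately show ?case using M N insert.hyps by (intro exI[of _ "M \<union> N"]) auto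
qed

section \<open>NTD-sets of paths\<close>

text \<open>A transfer to indices: whether the vertices with indices in \<open>T\<close> form an NTD-set can be
  verified with the edges of the path alone, since further edges of \<open>G\<close> do no harm.\<close>

lemma path_ntd:
  assumes g: "path_on g n" and T: "T \<subseteq> {..<n}"
    and sec: "\<forall>i<n. i \<notin> T \<longrightarrow> (\<exists>j\<in>T. j = Suc i \<or> i = Suc j) \<and>
      (\<exists>j<n. (j = Suc i \<or> i = Suc j) \<and> (j \<in> T \<longrightarrow> (\<exists>k\<in>T. k = Suc j \<or> j = Suc k)))"
  shows "ntd_in (g ` {..<n}) (g ` T)"
proof -
  have nb: "g i \<sim> g j" if "i < n" "j < n" "j = Suc i \<or> i = Suc j" for i j
    using g that adj_sym by (auto simp: path_on_def)
  have nonmem: "g j \<notin> g ` T" if "j < n" "j \<notin> T" for j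
    using g T that by (auto simp: path_on_def inj_on_def)
  have "secured (g ` {..<n}) (g ` T) (g i)" if i: "i < n" "i \<notin> T" for i
  proof -
    obtain j where j: "j \<in> T" "j = Suc i \<or> i = Suc j" using sec i by blast
    obtain k where k: "k < n" "k = Suc i \<or> i = Suc k"
      "k \<in> T \<longrightarrow> (\<exists>l\<in>T. l = Suc k \<or> k = Suc l)" using sec i by blast
    have ij: "g i \<sim> g j" and ik: "g i \<sim> g k" using nb i j k T by auto
    have gk: "g k \<notin> g ` T \<or> (\<exists>w\<in>g ` T. g k \<sim> w)"
    proof (cases "k \<in> T")
      case True
      then obtain l where "l \<in> T" "l = Suc k \<or> k = Suc l" using k by blast
      then show ?thesis using nb[of k l] k T by blast
    qed (use nonmem k in blast)
    show ?thesis
      unfolding secured_def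
    proof
      show "\<exists>u\<in>g ` T. g i \<sim> u" using ij j(1) by blast
      show "\<exists>u\<in>g ` {..<n}. g i \<sim> u \<and> (u \<notin> g ` T \<or> (\<exists>w\<in>g ` T. u \<sim> w))"
        by (rule bexI[of _ "g k"]) (use ik gk k(1) in simp_all)
    qed
  qed
  then have "\<forall>v\<in>g ` {..<n} - g ` T. secured (g ` {..<n}) (g ` T) v" by auto
  then show ?thesis using T by (auto simp: ntd_in_def)
qed

lemma path_half_secured_by_pattern:
  assumes g: "path_on g n" and T: "T \<subseteq> {..<n}" "2 * card T \<le> n"
    and "\<forall>i<n. i \<notin> T \<longrightarrow> (\<exists>j\<in>T. j = Suc i \<or> i = Suc j) \<and>
      (\<exists>j<n. (j = Suc i \<or> i = Suc j) \<and> (j \<in> T \<longrightarrow> (\<exists>k\<in>T. k = Suc j \<or> j = Suc k)))"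
  shows "half_secured (g ` {..<n})"
proof -
  have "card (g ` {..<n}) = n" "card (g ` T) = card T"
    using g T inj_on_subset[of g "{..<n}" T] by (auto simp: path_on_def card_image)
  moreover have "ntd_in (g ` {..<n}) (g ` T)" by (rule path_ntd[OF g T(1) assms(4)])
  ultimately show ?thesis unfolding half_secured_def using T(2) by (intro exI[of _ "g ` T"]) simp
qed

text \<open>
  The orders 4, 6, 7 and 9 are checked by hand; any larger order is reduced by cutting off four
  vertices. Order 9 needs its own pattern because cutting would leave five vertices, and \<open>P\<^sub>5\<close>
  has no suitable set.
\<close>

lemma path_half_secured:
  assumes "path_on g n" "4 \<le> n" "n \<noteq> 5"
  shows "half_secured (g ` {..<n})"
  using assms
proof (induction n arbitrary: g rule: less_induct)
  case (less n)
  consider "n = 4" | "n = 6" | "n = 7" | "n = 9" | "8 \<le> n" "n \<noteq> 9" using less.prems by force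
  then show ?case
  proof cases
    case 1
    show ?thesis
      by (rule path_half_secured_by_pattern[OF less.prems(1), of "{0,3}"])
        (auto simp: 1 less_Suc_eq numeral_eq_Suc)
  next
    case 2
    show ?thesis
      by (rule path_half_secured_by_pattern[OF less.prems(1), of "{0,3,4}"])
        (auto simp: 2 less_Suc_eq numeral_eq_Suc)
  next
    case 3
    show ?thesis
      by (rule path_half_secured_by_pattern[OF less.prems(1), of "{0,3,6}"])
        (auto simp: 3 less_Suc_eq numeral_eq_Suc)
  next
    case 4
    show ?thesis
      by (rule path_half_secured_by_pattern[OF less.prems(1), of "{0,3,6,7}"])
        (auto simp: 4 less_Suc_eq numeral_eq_Suc)
  next
    case 5
    define h where "h i = g (i + 4)" for i
    have "path_on g 4" using less.prems(1) 5 by (auto simp: path_on_def inj_on_def)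
    then have "half_secured (g ` {..<4})" using less.IH[of 4 g] 5 by simp
    moreover have "path_on h (n - 4)"
      unfolding path_on_def
    proof (intro conjI allI impI inj_onI)
      fix x y assume "x \<in> {..<n - 4}" "y \<in> {..<n - 4}" "h x = h y"
      then show "x = y"
        using less.prems(1) inj_onD[of g "{..<n}" "x + 4" "y + 4"] by (auto simp: path_on_def h_def)
    next
      fix i assume "Suc i < n - 4"
      then have "Suc (i + 4) < n" by simp
      then show "h i \<sim> h (Suc i)"
        using less.prems(1) unfolding path_on_def h_def by (metis add_Suc)
    qed
    then have "half_secured (h ` {..<n - 4})" using less.IH[of "n - 4" h] 5 by simp
    moreover have "h ` {..<n - 4} = g ` {4..<n}"
    proof -
      have "h = g \<circ> (\<lambda>i. i + 4)" by (auto simp: h_def)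
      then have "h ` {..<n - 4} = g ` ((\<lambda>i. i + 4) ` {0..<n - 4})"
        by (metis image_comp lessThan_atLeast0)
      also have "(\<lambda>i. i + 4) ` {0..<n - 4} = {4..<n}"
        unfolding image_add_atLeastLessThan' using 5 by simp
      finally show ?thesis .
    qed
    moreover have "g ` {..<4} \<inter> g ` {4..<n} = {}"
    proof -
      have "inj_on g {..<n}" using less.prems(1) by (simp add: path_on_def)
      then have "g ` ({..<4} \<inter> {4..<n}) = g ` {..<4} \<inter> g ` {4..<n}"
        using 5 by (intro inj_on_image_Int) auto
      then show ?thesis by auto
    qed
    moreover have "g ` {..<4} \<union> g ` {4..<n} = g ` {..<n}"
      using 5 by (simp add: image_Un[symmetric] ivl_disj_un(8))
    ultimately show ?thesis using half_secured_union[of "g ` {..<4}" "g ` {4..<n}"] by simp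
  qed
qed

section \<open>Path covers\<close>

lemma path_subgraph_enumeration:
  assumes "subgraph P G" "is_path P"
  obtains g n where "path_on g n" "g ` {..<n} = verts P" "n \<ge> 1"
proof -
  obtain n where n: "n \<ge> 1" "isomorphic P (path_graph n)" using assms(2) by (auto simp: is_path_def)
  have "verts (path_graph n) = {..<n}" by (simp add: path_graph_def)
  then obtain g where g: "bij_betw g {..<n} (verts P)"
    "\<forall>i<n. \<forall>j<n. adjacent P (g i) (g j) \<longleftrightarrow> adjacent (path_graph n) i j"
    using n(2) isomorphic_iff_enumeration by blast
  have "g i \<sim> g (Suc i)" if "Suc i < n" for i
  proof -
    have "adjacent P (g i) (g (Suc i))" using g(2) that by (simp add: adjacent_path_graph)
    then show ?thesis using assms(1) by (auto simp: adjacent_def subgraph_def)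
  qed
  then have "path_on g n" "g ` {..<n} = verts P" using g(1) by (auto simp: path_on_def bij_betw_def)
  then show thesis using n(1) that by blast
qed

text \<open>Without finiteness a cover could have cardinality 0 by being infinite.\<close>

lemma path_cover_finite:
  assumes "path_cover G C"
  shows "finite C"
proof (rule finite_subset)
  show "C \<subseteq> (\<lambda>(V, E). \<lparr>verts = V, edges = E\<rparr>) ` (Pow (verts G) \<times> Pow (edges G))"
  proof
    fix P assume "P \<in> C"
    then have "verts P \<subseteq> verts G" "edges P \<subseteq> edges G"
      using assms by (auto simp: path_cover_def subgraph_def)
    then show "P \<in> (\<lambda>(V, E). \<lparr>verts = V, edges = E\<rparr>) ` (Pow (verts G) \<times> Pow (edges G))"
      by (intro image_eqI[of _ _ "(verts P, edges P)"]) auto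
  qed
qed (use finite_edges in auto)

lemma path_cover_Union: "path_cover G C \<Longrightarrow> \<Union>(verts ` C) = verts G"
  unfolding path_cover_def subgraph_def by blast

text \<open>The matchings of the paths unite to a matching that misses at most one vertex per path.\<close>

lemma order_le_matching_plus_cover:
  assumes C: "path_cover G C"
  shows "card (verts G) \<le> 2 * matching_number G + card C"
proof -
  let ?F = "verts ` C"
  have finC: "finite C" using C by (rule path_cover_finite)
  have "X = Y" if "X \<in> ?F" "Y \<in> ?F" "v \<in> X" "v \<in> Y" for X Y v
  proof -
    have "v \<in> verts G" using path_cover_Union[OF C] that by blast
    then show ?thesis using C that unfolding path_cover_def by blast
  qed
  then have "pairwise disjnt ?F" unfolding pairwise_def disjnt_def by blast
  moreover have "finite X \<and> near_matched X" if "X \<in> ?F" for X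
  proof -
    from that obtain P where P: "P \<in> C" "X = verts P" by blast
    then obtain g n where "path_on g n" "g ` {..<n} = X"
      using C path_subgraph_enumeration unfolding path_cover_def by metis
    then show ?thesis using path_near_matched[of g n] by auto
  qed
  ultimately obtain M where M: "matching G M" "card (\<Union>?F) \<le> 2 * card M + card ?F"
    using near_matched_family[of ?F] finC by blast
  moreover have "card ?F \<le> card C" using finC by (rule card_image_le)
  ultimately show ?thesis using matching_card_le[OF M(1)] path_cover_Union[OF C] by simp
qed

lemma singletons_path_cover: "\<exists>C. path_cover G C"
proof -
  let ?P = "\<lambda>v. \<lparr>verts = {v}, edges = {}\<rparr>"
  have "is_path (?P v)" for v :: 'a
    unfolding is_path_def isomorphic_def
    by (intro exI[of _ 1] conjI exI[of _ "\<lambda>_. 0"])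
      (auto simp: path_graph_def adjacent_def bij_betw_def)
  then have "path_cover G (?P ` verts G)"
    by (auto simp: path_cover_def subgraph_def simple_graph_def)
  then show ?thesis by blast
qed

lemma minimum_path_cover:
  obtains C where "path_cover G C" "card C = path_covering_number G"
proof -
  have "\<exists>k C. path_cover G C \<and> card C = k" using singletons_path_cover by blast
  then show thesis using LeastI_ex[of "\<lambda>k. \<exists>C. path_cover G C \<and> card C = k"] that
    unfolding path_covering_number_def by blast
qed

lemma path_covering_number_pos:
  assumes "verts G \<noteq> {}"
  shows "1 \<le> path_covering_number G"
proof -
  obtain C where C: "path_cover G C" "card C = path_covering_number G" by (rule minimum_path_cover)
  have "C \<noteq> {}" using path_cover_Union[OF C(1)] assms by blast
  then have "card C \<noteq> 0" using path_cover_finite[OF C(1)] by simp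
  then show ?thesis using C(2) by simp
qed

lemma hamiltonian_path_of_cover:
  assumes "path_covering_number G = 1"
  obtains g n where "path_on g n" "g ` {..<n} = verts G"
proof -
  obtain C where C: "path_cover G C" "card C = path_covering_number G" by (rule minimum_path_cover)
  then obtain P where P: "C = {P}" using assms by (metis card_1_singletonE)
  then have "subgraph P G" "is_path P" using C by (auto simp: path_cover_def)
  moreover have "verts P = verts G" using path_cover_Union[OF C(1)] P by simp
  ultimately show thesis using path_subgraph_enumeration that by metis
qed

lemma path_covering_number_hamiltonian:
  assumes g: "path_on g n" "g ` {..<n} = verts G" "n \<ge> 1"
  shows "path_covering_number G = 1"
proof -
  define P where "P = \<lparr>verts = verts G, edges = {{g i, g (Suc i)} | i. Suc i < n}\<rparr>"
  have inj: "g i = g j \<longleftrightarrow> i = j" if "i < n" "j < n" for i j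
    using g(1) that by (auto simp: path_on_def inj_on_def)
  have "edges P \<subseteq> edges G" using g(1) by (auto simp: P_def path_on_def adjacent_def)
  moreover have "verts P = verts G" by (simp add: P_def)
  ultimately have sub: "subgraph P G"
    using simple unfolding subgraph_def simple_graph_def by (metis order_refl subsetD)
  have "adjacent P (g i) (g j) \<longleftrightarrow> adjacent (path_graph n) i j" if ij: "i < n" "j < n" for i j
  proof -
    have "adjacent P (g i) (g j) \<longleftrightarrow> (\<exists>k. Suc k < n \<and>
        (g i = g k \<and> g j = g (Suc k) \<or> g i = g (Suc k) \<and> g j = g k))"
      by (auto simp: adjacent_def P_def doubleton_eq_iff)
    also have "\<dots> \<longleftrightarrow> (\<exists>k. Suc k < n \<and> (i = k \<and> j = Suc k \<or> i = Suc k \<and> j = k))"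
      by (rule iff_exI) (rule conj_cong, simp_all add: inj ij)
    finally show ?thesis using ij by (auto simp: adjacent_path_graph)
  qed
  moreover have "bij_betw g {..<n} (verts P)" using g by (simp add: P_def bij_betw_def path_on_def)
  moreover have "verts (path_graph n) = {..<n}" by (simp add: path_graph_def)
  ultimately have "isomorphic P (path_graph n)" using isomorphic_iff_enumeration by blast
  then have "is_path P" using g(3) by (auto simp: is_path_def)
  with sub have "path_cover G {P}" by (auto simp: path_cover_def P_def)
  then have "\<exists>C. path_cover G C \<and> card C = 1" by (intro exI[of _ "{P}"]) auto
  then have "path_covering_number G \<le> 1" unfolding path_covering_number_def by (rule Least_le)
  moreover have "g 0 \<in> verts G" unfolding g(2)[symmetric] using g(3) by (intro imageI) simp
  then have "verts G \<noteq> {}" by blast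
  ultimately show ?thesis using path_covering_number_pos by simp
qed

section \<open>Hamiltonian paths on three and five vertices\<close>

lemma path_on_card: "path_on g n \<Longrightarrow> card (g ` {..<n}) = n"
  by (simp add: path_on_def card_image)

lemma path_on_3_half_secured:
  assumes g: "path_on g 3" "g ` {..<3} = verts G" and iso: "\<not> isomorphic G (path_graph 3)"
  shows "half_secured (verts G)"
proof -
  have edges: "g 0 \<sim> g 1" "g 1 \<sim> g 2" using g(1) by (auto simp: path_on_def numeral_eq_Suc)
  have V: "verts G = {g 0, g 1, g 2}" using g(2) by (auto simp: lessThan_Suc numeral_eq_Suc)
  have "g 0 \<sim> g 2"
  proof (rule ccontr)
    assume "\<not> g 0 \<sim> g 2"
    moreover from this have "\<not> g 2 \<sim> g 0" using adj_sym by blast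
    ultimately have "\<forall>i<3. \<forall>j<3. g i \<sim> g j \<longleftrightarrow> adjacent (path_graph 3) i j"
      using edges edges[THEN adj_sym]
      by (simp add: all_less_3 all_less_5 adjacent_path_graph)
    moreover have "bij_betw g {..<3} (verts G)" using g by (simp add: bij_betw_def path_on_def)
    moreover have "verts (path_graph 3) = {..<3}" by (simp add: path_graph_def)
    ultimately show False using iso isomorphic_iff_enumeration by blast
  qed
  then have "ntd_in (verts G) {g 1}"
    using edges adj_sym adj_irrefl unfolding V ntd_in_def secured_def by auto
  moreover have "card (verts G) = 3" using path_on_card[OF g(1)] g(2) by simp
  ultimately show ?thesis unfolding half_secured_def by (intro exI[of _ "{g 1}"]) auto
qed

lemma path_on_5_edges:
  assumes "path_on g 5"
  shows "g 0 \<sim> g 1" "g 1 \<sim> g 2" "g 2 \<sim> g 3" "g 3 \<sim> g 4"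
  using assms by (auto simp: path_on_def numeral_eq_Suc)

text \<open>Apart from the edge between the two ends of the path, which leads to \<open>C\<^sub>5\<close>, every chord creates
  two adjacent vertices that together dominate the graph.\<close>

lemma path_on_5_half_secured:
  assumes g: "path_on g 5" "g ` {..<5} = verts G"
    and iso: "\<not> isomorphic G (path_graph 5)" "\<not> isomorphic G (cycle_graph 5)"
  shows "half_secured (verts G)"
proof -
  note edges = path_on_5_edges[OF g(1)]
  have bij: "bij_betw g {..<5} (verts G)" using g by (simp add: bij_betw_def path_on_def)
  have V: "verts G = {g 0, g 1, g 2, g 3, g 4}"
    using g(2) by (auto simp: lessThan_Suc numeral_eq_Suc)
  have "g 0 \<sim> g 2 \<or> g 2 \<sim> g 4 \<or> g 0 \<sim> g 3 \<or> g 1 \<sim> g 4 \<or> g 1 \<sim> g 3"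
  proof (rule ccontr)
    assume no: "\<not> ?thesis"
    then have no_rev: "\<not> g 2 \<sim> g 0" "\<not> g 4 \<sim> g 2" "\<not> g 3 \<sim> g 0" "\<not> g 4 \<sim> g 1" "\<not> g 3 \<sim> g 1"
      and end_rev: "g 4 \<sim> g 0 \<longleftrightarrow> g 0 \<sim> g 4"
      using adj_sym by blast+
    show False
    proof (cases "g 0 \<sim> g 4")
      case False
      then have "\<forall>i<5. \<forall>j<5. g i \<sim> g j \<longleftrightarrow> adjacent (path_graph 5) i j"
        using edges edges[THEN adj_sym] no no_rev end_rev
        by (simp add: all_less_3 all_less_5 adjacent_path_graph)
      moreover have "verts (path_graph 5) = {..<5}" by (simp add: path_graph_def)
      ultimately show False using iso(1) bij isomorphic_iff_enumeration by blast
    next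
      case True
      then have "\<forall>i<5. \<forall>j<5. g i \<sim> g j \<longleftrightarrow> adjacent (cycle_graph 5) i j"
        using edges edges[THEN adj_sym] no no_rev end_rev
        by (simp add: all_less_5 adjacent_cycle_graph)
      moreover have "verts (cycle_graph 5) = {..<5}" by (simp add: cycle_graph_def)
      ultimately show False using iso(2) bij isomorphic_iff_enumeration by blast
    qed
  qed
  then have "\<exists>a b. ntd_in (verts G) {a, b}"
  proof (elim disjE)
    assume "g 0 \<sim> g 2"
    then have "ntd_in (verts G) {g 2, g 3}"
      using edges adj_sym by (intro adjacent_pair_ntd) (auto simp: V)
    then show ?thesis by blast
  next
    assume "g 2 \<sim> g 4"
    then have "ntd_in (verts G) {g 1, g 2}"
      using edges adj_sym by (intro adjacent_pair_ntd) (auto simp: V)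
    then show ?thesis by blast
  next
    assume "g 0 \<sim> g 3"
    then have "ntd_in (verts G) {g 2, g 3}"
      using edges adj_sym by (intro adjacent_pair_ntd) (auto simp: V)
    then show ?thesis by blast
  next
    assume "g 1 \<sim> g 4"
    then have "ntd_in (verts G) {g 1, g 2}"
      using edges adj_sym by (intro adjacent_pair_ntd) (auto simp: V)
    then show ?thesis by blast
  next
    assume "g 1 \<sim> g 3"
    then have "ntd_in (verts G) {g 1, g 3}"
      using edges adj_sym by (intro adjacent_pair_ntd) (auto simp: V)
    then show ?thesis by blast
  qed
  then obtain a b where "ntd_in (verts G) {a, b}" by blast
  moreover have "card {a, b} \<le> 2" by (simp add: card_insert_if)
  moreover have "card (verts G) = 5" using path_on_card[OF g(1)] g(2) by simp
  ultimately show ?thesis unfolding half_secured_def by (intro exI[of _ "{a, b}"]) auto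
qed

section \<open>The upper bound\<close>

lemma ntd_number_bound:
  assumes connected: "connected_graph G" and n3: "3 \<le> card (verts G)"
    and iso: "\<not> isomorphic G (path_graph 3)" "\<not> isomorphic G (path_graph 5)"
      "\<not> isomorphic G (cycle_graph 5)"
  shows "2 * ntd_number G \<le> 2 * matching_number G + path_covering_number G"
proof -
  obtain C where C: "path_cover G C" "card C = path_covering_number G" by (rule minimum_path_cover)
  have n: "card (verts G) \<le> 2 * matching_number G + path_covering_number G"
    using order_le_matching_plus_cover[OF C(1)] C(2) by simp
  have suffices: ?thesis if "half_secured (verts G)" using half_secured_ntd_number[OF that] n by simp
  have "verts G \<noteq> {}" using n3 by auto
  then have "1 \<le> path_covering_number G" by (rule path_covering_number_pos)
  \<comment> \<open>With two or more paths the bound has enough slack for a spanning spider; with one path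
    a Hamiltonian path takes over.\<close>
  then consider "path_covering_number G = 1" | "2 \<le> path_covering_number G" by linarith
  then show ?thesis
  proof cases
    case 1
    then obtain g k where g: "path_on g k" "g ` {..<k} = verts G"
      by (rule hamiltonian_path_of_cover)
    then have "3 \<le> k" using n3 path_on_card[OF g(1)] by simp
    then consider "k = 3" | "k = 5" | "4 \<le> k" "k \<noteq> 5" by linarith
    then have "half_secured (verts G)"
      using g iso path_on_3_half_secured path_on_5_half_secured path_half_secured[OF g(1)] by cases auto
    then show ?thesis by (rule suffices)
  next
    case 2
    have "half_secured (verts G) \<or> spider_or_edge (verts G)"
      using connected_set_dichotomy connected_graph_connected_set[OF connected] by simp
    then consider "half_secured (verts G)" | c where "spider c (verts G)" | a b where "verts G = {a, b}"
      unfolding spider_or_edge_def by blast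
    then show ?thesis
    proof cases
      case 2
      then obtain S where S: "ntd_in (verts G) S" "2 * card S = card (verts G) + 1"
        using spider_ntd n3 by (metis One_nat_def Suc_n_not_le_n numeral_3_eq_3 Suc_le_mono le_SucI)
      obtain M where M: "matching G M" "card (verts G) \<le> 2 * card M + 1"
        using spider_near_matched[OF 2] unfolding near_matched_def by blast
      show ?thesis
        using ntd_number_le[OF S(1)] S(2) M(2) matching_card_le[OF M(1)] \<open>2 \<le> path_covering_number G\<close>
        by linarith
    next
      case 3
      then have "card (verts G) \<le> 2" by (simp add: card_insert_if)
      then show ?thesis using n3 by simp
    qed (rule suffices)
  qed
qed

section \<open>The exceptional graphs\<close>

text \<open>The matching number is squeezed between \<open>n \<le> 2 \<alpha>' + 1\<close> and \<open>2 \<alpha>' \<le> n\<close>.\<close>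

lemma hamiltonian_odd_numbers:
  assumes g: "path_on g (2 * k + 1)" "g ` {..<2 * k + 1} = verts G"
  shows "path_covering_number G = 1" "matching_number G = k"
proof -
  show pc: "path_covering_number G = 1" by (rule path_covering_number_hamiltonian[OF g]) simp
  obtain C where C: "path_cover G C" "card C = path_covering_number G" by (rule minimum_path_cover)
  have "card (verts G) = 2 * k + 1" using path_on_card[OF g(1)] g(2) by simp
  then show "matching_number G = k"
    using order_le_matching_plus_cover[OF C(1)] C(2) pc twice_matching_number_le by simp
qed

text \<open>Counting a set by membership of its possible elements turns a lower bound on the size of
  NTD-sets of a small graph into a propositional statement.\<close>

lemma card_preimage_bool:
  assumes "path_on g n" "S \<subseteq> g ` {..<n}"
  shows "card S = (\<Sum>i<n. of_bool (g i \<in> S))"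
proof -
  have "S = g ` {i \<in> {..<n}. g i \<in> S}" using assms(2) by auto
  moreover have "inj_on g {i \<in> {..<n}. g i \<in> S}"
    using assms(1) by (auto simp: path_on_def intro: inj_on_subset)
  ultimately have "card S = card {i \<in> {..<n}. g i \<in> S}" by (metis card_image)
  also have "\<dots> = (\<Sum>i<n. of_bool (g i \<in> S))" by (simp add: sum_of_bool_eq Int_def)
  finally show ?thesis .
qed

lemma ntd_number_P3:
  assumes "isomorphic G (path_graph 3)"
  shows "ntd_number G = 2 \<and> matching_number G = 1 \<and> path_covering_number G = 1"
proof -
  have "verts (path_graph 3) = {..<3}" by (simp add: path_graph_def)
  then obtain g where bij: "bij_betw g {..<3} (verts G)"
    and adj: "\<forall>i<3. \<forall>j<3. g i \<sim> g j \<longleftrightarrow> adjacent (path_graph 3) i j"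
    using assms isomorphic_iff_enumeration by blast
  have g: "path_on g 3" "g ` {..<3} = verts G"
    using bij adj by (auto simp: path_on_def bij_betw_def adjacent_path_graph)
  have V: "verts G = {g 0, g 1, g 2}" using g(2) by (auto simp: lessThan_Suc numeral_eq_Suc)
  have edges: "g 0 \<sim> g 1" "g 1 \<sim> g 2" "g 1 \<sim> g 0" "g 2 \<sim> g 1" "\<not> g 0 \<sim> g 2" "\<not> g 2 \<sim> g 0"
    using adj by (simp_all add: adjacent_path_graph)
  have "ntd_number G = 2"
  proof (rule ntd_number_eqI)
    show "ntd_in (verts G) {g 0, g 1}"
      using edges by (intro adjacent_pair_ntd) (auto simp: V)
    show "card {g 0, g 1} = 2" using edges(1) by (auto simp: card_insert_if)
    fix S assume S: "ntd_in (verts G) S"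
    then have "card S = (\<Sum>i<3. of_bool (g i \<in> S))"
      using card_preimage_bool[OF g(1)] g(2) by (simp add: ntd_in_def)
    moreover have sec: "v \<in> S \<or> secured (verts G) S v" if "v \<in> verts G" for v
      using S that by (auto simp: ntd_in_def)
    have SV: "S \<subseteq> verts G" using S by (simp add: ntd_in_def)
    have ex: "(\<exists>u\<in>S. P u) \<longleftrightarrow> g 0 \<in> S \<and> P (g 0) \<or> g 1 \<in> S \<and> P (g 1) \<or> g 2 \<in> S \<and> P (g 2)" for P
    proof -
      have "(\<exists>u\<in>S. P u) \<longleftrightarrow> (\<exists>u\<in>verts G. u \<in> S \<and> P u)" using SV by blast
      then show ?thesis by (simp add: V)
    qed
    have "2 \<le> (\<Sum>i<3. of_bool (g i \<in> S) :: nat)"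
      using sec[of "g 0"] sec[of "g 1"] sec[of "g 2"] edges
      by (cases "g 0 \<in> S"; cases "g 1 \<in> S"; cases "g 2 \<in> S")
        (simp_all add: secured_def ex V numeral_eq_Suc)
    ultimately show "2 \<le> card S" by simp
  qed
  then show ?thesis using hamiltonian_odd_numbers[of g 1] g by (simp add: numeral_eq_Suc)
qed

text \<open>
  Both graphs are treated at once: they differ only in the edge between \<open>g 0\<close> and \<open>g 4\<close>, which is
  left undetermined in the case distinction on membership in \<open>S\<close>.
\<close>

lemma ntd_number_P5_C5:
  assumes "isomorphic G (path_graph 5) \<or> isomorphic G (cycle_graph 5)"
  shows "ntd_number G = 3 \<and> matching_number G = 2 \<and> path_covering_number G = 1"
proof -
  have "verts (path_graph 5) = {..<5}" "verts (cycle_graph 5) = {..<5}"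
    by (simp_all add: path_graph_def cycle_graph_def)
  then obtain g where bij: "bij_betw g {..<5} (verts G)"
    and adj: "(\<forall>i<5. \<forall>j<5. g i \<sim> g j \<longleftrightarrow> adjacent (path_graph 5) i j) \<or>
      (\<forall>i<5. \<forall>j<5. g i \<sim> g j \<longleftrightarrow> adjacent (cycle_graph 5) i j)"
    using assms isomorphic_iff_enumeration by metis
  have "g i \<sim> g (Suc i)" if "Suc i < 5" for i
    using adj that by (auto simp: adjacent_path_graph adjacent_cycle_graph)
  then have g: "path_on g 5" "g ` {..<5} = verts G"
    using bij by (auto simp: path_on_def bij_betw_def)
  have V: "verts G = {g 0, g 1, g 2, g 3, g 4}" using g(2) by (auto simp: lessThan_Suc numeral_eq_Suc)
  note edges = path_on_5_edges[OF g(1)]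
  have chordless: "\<not> g 0 \<sim> g 2" "\<not> g 0 \<sim> g 3" "\<not> g 1 \<sim> g 3" "\<not> g 1 \<sim> g 4" "\<not> g 2 \<sim> g 4"
    using adj by (auto simp: adjacent_path_graph adjacent_cycle_graph)
  note sym = edges[THEN adj_sym]
  have nsym: "\<not> g 2 \<sim> g 0" "\<not> g 3 \<sim> g 0" "\<not> g 3 \<sim> g 1" "\<not> g 4 \<sim> g 1" "\<not> g 4 \<sim> g 2"
    using chordless adj_sym by blast+
  have c: "g 4 \<sim> g 0 \<longleftrightarrow> g 0 \<sim> g 4" using adj_sym by blast
  have "ntd_number G = 3"
  proof (rule ntd_number_eqI)
    show "ntd_in (verts G) {g 1, g 2, g 3}"
      unfolding ntd_in_def secured_def V using edges sym by auto
    show "card {g 1, g 2, g 3} = 3"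
      using edges chordless nsym by (auto simp: card_insert_if)
    fix S assume S: "ntd_in (verts G) S"
    then have "card S = (\<Sum>i<5. of_bool (g i \<in> S))"
      using card_preimage_bool[OF g(1)] g(2) by (simp add: ntd_in_def)
    moreover have sec: "v \<in> S \<or> secured (verts G) S v" if "v \<in> verts G" for v
      using S that by (auto simp: ntd_in_def)
    have SV: "S \<subseteq> verts G" using S by (simp add: ntd_in_def)
    have ex: "(\<exists>u\<in>S. P u) \<longleftrightarrow> g 0 \<in> S \<and> P (g 0) \<or> g 1 \<in> S \<and> P (g 1) \<or> g 2 \<in> S \<and> P (g 2) \<or>
      g 3 \<in> S \<and> P (g 3) \<or> g 4 \<in> S \<and> P (g 4)" for P
    proof -
      have "(\<exists>u\<in>S. P u) \<longleftrightarrow> (\<exists>u\<in>verts G. u \<in> S \<and> P u)" using SV by blast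
      then show ?thesis by (simp add: V)
    qed
    have sum: "(\<Sum>i<5. f i) = f 0 + f 1 + f 2 + f 3 + f 4" for f :: "nat \<Rightarrow> nat"
      by (simp add: numeral_eq_Suc)
    note expand = secured_def ex V bex_simps HOL.simp_thms adj_irrefl c edges edges[THEN adj_sym] chordless nsym
    have s0: "g 0 \<in> S \<or> secured (verts G) S (g 0)" using sec[of "g 0"] by (simp add: V)
    have s1: "g 1 \<in> S \<or> secured (verts G) S (g 1)" using sec[of "g 1"] by (simp add: V)
    have s2: "g 2 \<in> S \<or> secured (verts G) S (g 2)" using sec[of "g 2"] by (simp add: V)
    have s3: "g 3 \<in> S \<or> secured (verts G) S (g 3)" using sec[of "g 3"] by (simp add: V)
    have s4: "g 4 \<in> S \<or> secured (verts G) S (g 4)" using sec[of "g 4"] by (simp add: V)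
    note props = s0[simplified expand] s1[simplified expand] s2[simplified expand]
      s3[simplified expand] s4[simplified expand]
    have "3 \<le> (\<Sum>i<5. of_bool (g i \<in> S) :: nat)"
      unfolding sum using props
      by (cases "g 0 \<in> S"; cases "g 1 \<in> S"; cases "g 2 \<in> S"; cases "g 3 \<in> S"; cases "g 4 \<in> S")
        simp_all
    ultimately show "3 \<le> card S" by simp
  qed
  then show ?thesis using hamiltonian_odd_numbers[of g 2] g by (simp add: numeral_eq_Suc)
qed

end

theorem corollary9:
  fixes G :: "'a ugraph"
  assumes "simple_graph G"
    and "connected_graph G"
    and "card (verts G) \<ge> 3"
  shows "(if isomorphic G (path_graph 3) \<or> isomorphic G (path_graph 5) \<or> isomorphic G (cycle_graph 5)
          then real (ntd_number G) =
                 real (matching_number G) + 1 / 2 * (real (path_covering_number G) + 1)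
          else real (ntd_number G) \<le>
                 real (matching_number G) + 1 / 2 * real (path_covering_number G))"
proof -
  interpret finite_simple_graph G using assms(1) by unfold_locales
  show ?thesis
  proof (cases "isomorphic G (path_graph 3) \<or> isomorphic G (path_graph 5) \<or> isomorphic G (cycle_graph 5)")
    case True
    then show ?thesis using ntd_number_P3 ntd_number_P5_C5 by auto
  next
    case False
    then have "2 * ntd_number G \<le> 2 * matching_number G + path_covering_number G"
      using ntd_number_bound assms(2,3) by blast
    then have "real (2 * ntd_number G) \<le> real (2 * matching_number G + path_covering_number G)"
      by (rule of_nat_mono)
    then show ?thesis using False by simp
  qed
qed

end
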